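(* Let $A$ be a semisimple complex Banach algebra with identity such that $\mathrm{Soc}\,A\neq\{0\}$. For any linear functional $f$ on $\mathrm{Soc}\,A$, we have $f=\alpha\,\mathrm{Tr}$ for some $\alpha\in\mathbb{C}$ if and only if $f$ is constant on the set of rank one projections of $A$.
   Context: $A$ is a semisimple complex Banach algebra with identity $\mathbf 1$. For $x\in A$, $\sigma(x)$ is the spectrum and $\sigma'(x)=\sigma(x)\setminus\{0\}$; $\#K$ denotes the number of elements of a set $K$. The rank of $a\in A$ is $\mathrm{rank}(a)=\sup_{x\in A}\#\sigma'(xa)\in\{0,1,2,\dots\}\cup\{\infty\}$. A projection is an idempotent $p=p^2\in A$. The socle $\mathrm{Soc}\,A$ is the two-sided ideal of all finite-rank elements of $A$ (it coincides with the usual socle, the sum of all minimal left ideals, and is $\{0\}$ if there are none). For $a\in \mathrm{Soc}\,A$ let $E(a)=\{x\in A:\#\sigma'(xa)=\mathrm{rank}(a)\}$, which is a dense open subset of $A$. For $a\in\mathrm{Soc}\,A$ and $\lambda\in\sigma(a)$, let $B(\lambda,r)$ be an open disk whose closure contains no point of $\sigma(a)$ other than $\lambda$; there is an open ball $U\subseteq A$ centered at $\mathbf 1$ such that $\#[\sigma(xa)\cap B(\lambda,r)]$ is constant for $x\in E(a)\cap U$, and this constant is the multiplicity $m(\lambda,a)$. The trace is $\mathrm{Tr}(a)=\sum_{\lambda\in\sigma(a)}\lambda\, m(\lambda,a)$ for $a\in\mathrm{Soc}\,A$; it is a linear functional on $\mathrm{Soc}\,A$. Linear functionals are complex-linear and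 not assumed continuous. *)

theory Defs
  imports "HOL-Analysis.Analysis" "HOL-Library.Extended_Nat"
begin

text \<open>
  Complex Banach algebras with identity. The real structure of the library classes is required to
  be the restriction of the complex one. No normalisation of the norm of the identity is assumed,
  so the class covers the usual convention that it has norm 1.
\<close>

class complex_banach_algebra = real_algebra_1 + real_normed_algebra + banach +
  fixes scaleC :: "complex \<Rightarrow> 'a \<Rightarrow> 'a"  (infixr \<open>*\<^sub>C\<close> 75)
  assumes scaleC_add_right: "c *\<^sub>C (x + y) = c *\<^sub>C x + c *\<^sub>C y"
    and scaleC_add_left: "(c + d) *\<^sub>C x = c *\<^sub>C x + d *\<^sub>C x"
    and scaleC_scaleC: "c *\<^sub>C (d *\<^sub>C x) = (c * d) *\<^sub>C x"
    and scaleC_one: "1 *\<^sub>C x = x"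
    and scaleR_scaleC: "r *\<^sub>R x = complex_of_real r *\<^sub>C x"
    and mult_scaleC_left: "(c *\<^sub>C x) * y = c *\<^sub>C (x * y)"
    and mult_scaleC_right: "x * (c *\<^sub>C y) = c *\<^sub>C (x * y)"
    and norm_scaleC: "norm (c *\<^sub>C x) = cmod c * norm x"

definition left_ideal :: "'a::ring_1 set \<Rightarrow> bool" where
  "left_ideal L \<longleftrightarrow>
     0 \<in> L \<and> (\<forall>x\<in>L. \<forall>y\<in>L. x + y \<in> L) \<and> (\<forall>a. \<forall>x\<in>L. a * x \<in> L)"

definition maximal_left_ideal :: "'a::ring_1 set \<Rightarrow> bool" where
  "maximal_left_ideal L \<longleftrightarrow>
     left_ideal L \<and> L \<noteq> UNIV \<and> (\<forall>M. left_ideal M \<and> L \<subseteq> M \<longrightarrow> M = L \<or> M = UNIV)"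

definition jacobson_radical :: "'a::ring_1 set" where
  "jacobson_radical = \<Inter> {L. maximal_left_ideal L}"

definition semisimple :: "'a::ring_1 itself \<Rightarrow> bool" where
  "semisimple _ \<longleftrightarrow> jacobson_radical = {0::'a}"

definition has_two_sided_inverse :: "'a::ring_1 \<Rightarrow> bool" where
  "has_two_sided_inverse x \<longleftrightarrow> (\<exists>y. x * y = 1 \<and> y * x = 1)"

definition spectrum :: "'a::complex_banach_algebra \<Rightarrow> complex set" where
  "spectrum x = {c. \<not> has_two_sided_inverse (c *\<^sub>C 1 - x)}"

definition nonzero_spectrum :: "'a::complex_banach_algebra \<Rightarrow> complex set" where
  "nonzero_spectrum x = spectrum x - {0}"

definition ecard :: "'b set \<Rightarrow> enat" where
  "ecard K = (if finite K then enat (card K) else \<infinity>)"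

definition spectral_rank :: "'a::complex_banach_algebra \<Rightarrow> enat" where
  "spectral_rank a = (SUP x. ecard (nonzero_spectrum (x * a)))"

definition socle :: "'a::complex_banach_algebra set" where
  "socle = {a. spectral_rank a < \<infinity>}"

definition rank_attaining :: "'a::complex_banach_algebra \<Rightarrow> 'a set" where
  "rank_attaining a = {x. ecard (nonzero_spectrum (x * a)) = spectral_rank a}"

text \<open>
  The multiplicity is characterised by every admissible radius at once; it is only meaningful
  for \<open>a\<close> in the socle and \<open>c\<close> in the spectrum of \<open>a\<close>.
\<close>

definition spectral_multiplicity :: "complex \<Rightarrow> 'a::complex_banach_algebra \<Rightarrow> nat" where
  "spectral_multiplicity c a =
     (THE n. \<forall>r>0. cball c r \<inter> spectrum a \<subseteq> {c} \<longrightarrow>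
        (\<exists>\<epsilon>>0. \<forall>x \<in> rank_attaining a \<inter> ball 1 \<epsilon>. ecard (spectrum (x * a) \<inter> ball c r) = enat n))"

definition socle_trace :: "'a::complex_banach_algebra \<Rightarrow> complex" where
  "socle_trace a = (\<Sum>c\<in>spectrum a. c * of_nat (spectral_multiplicity c a))"

text \<open>Functions are total, so functionals on a subspace are constrained only on that subspace.\<close>

definition linear_functional_on ::
    "'a::complex_banach_algebra set \<Rightarrow> ('a \<Rightarrow> complex) \<Rightarrow> bool" where
  "linear_functional_on S f \<longleftrightarrow>
     (\<forall>x\<in>S. \<forall>y\<in>S. f (x + y) = f x + f y) \<and> (\<forall>c. \<forall>x\<in>S. f (c *\<^sub>C x) = c * f x)"

definition rank_one_projections :: "'a::complex_banach_algebra set" where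
  "rank_one_projections = {p. p * p = p \<and> spectral_rank p = 1}"

end

(*
  Let a have rank n, attained at x. The spectral idempotents of x a give n orthogonal nonzero
  idempotents in A a, and maximality of n forces, by counting spectral values and semisimplicity,
  that each of them is minimal (p A p = C p), that a is fixed by their sum, and that x a is a linear
  combination of them. If p is minimal then p + (1 - p) u p is again a minimal idempotent, so a
  functional T with value 1 on minimal idempotents satisfies T (u p) = c where p u p = c p; in
  particular T is bounded on A a. For x in E(a) and a polynomial G with G(0) = 0 this gives
  T (G (x a)) as the sum of G over the nonzero spectrum of x a. Letting x tend to 1 inside E(a), with
  G a Lagrange polynomial of the spectrum of a, identifies the multiplicities, whence T = Tr on a.
  That 1 is a limit of points of E(a) follows from a triangularization in a finite-rank corner in
  which T counts dimensions. Thus the linearity of Tr need not be known in advance: a functional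
  that is a nonzero constant on rank one projections serves, after scaling, as the trace itself.
*)

theory Submission
  imports Defs "HOL-Computational_Algebra.Fundamental_Theorem_Algebra"
    "HOL-Computational_Algebra.Formal_Power_Series"
begin

text \<open>The spectral idempotents come from polynomials instead of contour integrals: a Lagrange
  polynomial of \<open>x * a\<close> is idempotent up to a commuting error q without nonzero
  spectrum, and the series of (1 - 4 q) to the power -1/2 repairs it. This needs geometric decay of
  norm (q ^ n), hence the form of the spectral radius formula proved below.
  \<open>nonzero_spectrum\<close> is the working notion because x y and y x share it, which carries
  spectral information between A and a corner p A p. For fixed a everything happens in the left
  ideal A a: its elements are visibly multiples y a and lie in the socle, so the functional is
  assumed linear only there. The obstacle is the definition of multiplicity: its condition
  quantifies over rank-attaining elements near 1 and would hold vacuously for every number if some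
  ball around 1 contained none. So a perturbation has to be constructed, and the induction behind it
  needs a dimension function on idempotents of A a; the normalized functional supplies one before
  the trace is known to be additive.\<close>

interpretation scaleC: vector_space "scaleC :: complex \<Rightarrow> 'a::complex_banach_algebra \<Rightarrow> 'a"
  by unfold_locales
    (simp_all add: scaleC_add_right scaleC_add_left scaleC_scaleC scaleC_one)

declare mult_scaleC_left [simp] mult_scaleC_right [simp]

section \<open>Invertibility and the nonzero spectrum\<close>

abbreviation invertible_elem :: "'a::ring_1 \<Rightarrow> bool" where
  "invertible_elem \<equiv> has_two_sided_inverse"

lemma invertible_elemI: "x * y = 1 \<Longrightarrow> y * x = 1 \<Longrightarrow> invertible_elem x"
  unfolding has_two_sided_inverse_def by blast

lemma invertible_elem_mult:
  assumes "invertible_elem x" "invertible_elem y" shows "invertible_elem (x * y)"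
proof -
  obtain x' where x: "x * x' = 1" "x' * x = 1"
    using assms(1) unfolding has_two_sided_inverse_def by blast
  obtain y' where y: "y * y' = 1" "y' * y = 1"
    using assms(2) unfolding has_two_sided_inverse_def by blast
  show ?thesis
  proof (rule invertible_elemI)
    have "x * y * (y' * x') = x * (y * y') * x'" by (simp only: mult.assoc)
    then show "x * y * (y' * x') = 1" using x y by simp
    have "y' * x' * (x * y) = y' * (x' * x) * y" by (simp only: mult.assoc)
    then show "y' * x' * (x * y) = 1" using x y by simp
  qed
qed

lemma invertible_elem_cancel_right:
  assumes "invertible_elem (x * y)" "invertible_elem y" shows "invertible_elem x"
proof -
  obtain w where w: "(x * y) * w = 1" "w * (x * y) = 1"
    using assms(1) unfolding has_two_sided_inverse_def by blast
  obtain y' where y: "y * y' = 1" "y' * y = 1"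
    using assms(2) unfolding has_two_sided_inverse_def by blast
  have "x = (x * y) * y'" using y by (simp add: mult.assoc)
  then have "(y * w) * x = y * (w * (x * y)) * y'" by (simp add: mult.assoc)
  then have "(y * w) * x = 1" using w y by simp
  moreover have "x * (y * w) = 1" using w by (simp add: mult.assoc)
  ultimately show ?thesis by (intro invertible_elemI)
qed

text \<open>Both factors acquire a left and a right inverse from \<open>w\<close>; commutation is
  what puts one of each on the same factor.\<close>

lemma invertible_elem_factor:
  assumes "invertible_elem (x * y)" "x * y = y * x" shows "invertible_elem x" "invertible_elem y"
proof -
  obtain w where w: "(x * y) * w = 1" "w * (x * y) = 1"
    using assms(1) unfolding has_two_sided_inverse_def by blast
  have 1: "x * (y * w) = 1" "(w * x) * y = 1" using w by (simp_all add: mult.assoc)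
  have 2: "(w * y) * x = 1" "y * (x * w) = 1" using w assms(2) by (simp_all add: mult.assoc)
  have "y * w = w * y" by (metis 1(1) 2(1) mult.assoc mult.right_neutral mult.left_neutral)
  moreover have "x * w = w * x" by (metis 1(2) 2(2) mult.assoc mult.right_neutral mult.left_neutral)
  ultimately show "invertible_elem x" "invertible_elem y" using 1 2 by (metis invertible_elemI)+
qed

lemma invertible_elem_scaleC:
  fixes x :: "'a::complex_banach_algebra"
  assumes "c \<noteq> 0" shows "invertible_elem (c *\<^sub>C x) \<longleftrightarrow> invertible_elem x"
proof -
  have *: "invertible_elem (c *\<^sub>C x)" if x: "invertible_elem x" "c \<noteq> 0" for c and x :: 'a
  proof -
    obtain y where "x * y = 1" "y * x = 1"
      using x(1) unfolding has_two_sided_inverse_def by blast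
    then show ?thesis by (intro invertible_elemI[of _ "inverse c *\<^sub>C y"]) (simp_all add: x)
  qed
  show ?thesis using *[of x c] *[of "c *\<^sub>C x" "inverse c"] assms by auto
qed

text \<open>Jacobson's identity: the formal geometric series suggests 1 + y (1 - x y)^-1 x as the
  inverse of 1 - y x.\<close>

lemma invertible_elem_one_minus_swap:
  fixes x y :: "'a::ring_1"
  assumes "invertible_elem (1 - x * y)" shows "invertible_elem (1 - y * x)"
proof -
  obtain w where w: "(1 - x * y) * w = 1" "w * (1 - x * y) = 1"
    using assms unfolding has_two_sided_inverse_def by blast
  show ?thesis
  proof (rule invertible_elemI[of _ "1 + y * w * x"])
    have "(1 - y * x) * (1 + y * w * x) = 1 - y * x + y * ((1 - x * y) * w) * x"
      by (simp add: algebra_simps)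
    then show "(1 - y * x) * (1 + y * w * x) = 1" using w by simp
    have "(1 + y * w * x) * (1 - y * x) = 1 - y * x + y * (w * (1 - x * y)) * x"
      by (simp add: algebra_simps)
    then show "(1 + y * w * x) * (1 - y * x) = 1" using w by simp
  qed
qed

lemma nonzero_spectrum_iff:
  fixes x :: "'a::complex_banach_algebra"
  shows "c \<in> nonzero_spectrum x \<longleftrightarrow> c \<noteq> 0 \<and> \<not> invertible_elem (1 - inverse c *\<^sub>C x)"
proof -
  have "c *\<^sub>C 1 - x = c *\<^sub>C (1 - inverse c *\<^sub>C x)" if "c \<noteq> 0"
    using that by (simp add: algebra_simps)
  then show ?thesis unfolding nonzero_spectrum_def spectrum_def
    by (auto simp: invertible_elem_scaleC)
qed

lemma nonzero_spectrum_swap: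
  fixes x :: "'a::complex_banach_algebra"
  shows "nonzero_spectrum (x * y) = nonzero_spectrum (y * x)"
proof -
  have "invertible_elem (1 - c *\<^sub>C (x * y))" if "invertible_elem (1 - c *\<^sub>C (y * x))" for c and x y :: 'a
    using invertible_elem_one_minus_swap[of y "c *\<^sub>C x"] that by simp
  then show ?thesis by (auto simp: nonzero_spectrum_iff)
qed

lemma nonzero_spectrum_zero [simp]: "nonzero_spectrum (0::'a::complex_banach_algebra) = {}"
  by (auto simp: nonzero_spectrum_iff has_two_sided_inverse_def)

text \<open>1 - c (u + z) splits as the commuting product (1 - c u) (1 - c z), since both cross
  products vanish.\<close>

lemma nonzero_spectrum_add_orthogonal:
  fixes u z :: "'a::complex_banach_algebra"
  assumes "u * z = 0" "z * u = 0"
  shows "nonzero_spectrum (u + z) = nonzero_spectrum u \<union> nonzero_spectrum z"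
proof -
  have "invertible_elem (1 - c *\<^sub>C (u + z)) \<longleftrightarrow> invertible_elem (1 - c *\<^sub>C u) \<and> invertible_elem (1 - c *\<^sub>C z)" for c
  proof -
    have "1 - c *\<^sub>C (u + z) = (1 - c *\<^sub>C u) * (1 - c *\<^sub>C z)"
      "(1 - c *\<^sub>C u) * (1 - c *\<^sub>C z) = (1 - c *\<^sub>C z) * (1 - c *\<^sub>C u)"
      using assms by (simp_all add: algebra_simps)
    then show ?thesis using invertible_elem_mult invertible_elem_factor by metis
  qed
  then show ?thesis by (auto simp: nonzero_spectrum_iff)
qed

lemma eigenvalue_in_nonzero_spectrum:
  fixes x y :: "'a::complex_banach_algebra"
  assumes "x * y = c *\<^sub>C y" "y \<noteq> 0" "c \<noteq> 0"
  shows "c \<in> nonzero_spectrum x"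
proof -
  have "(1 - inverse c *\<^sub>C x) * y = 0" using assms by (simp add: algebra_simps)
  then have "\<not> invertible_elem (1 - inverse c *\<^sub>C x)" using \<open>y \<noteq> 0\<close>
    unfolding has_two_sided_inverse_def by (metis mult.assoc mult_1 mult_zero_right)
  then show ?thesis using assms by (simp add: nonzero_spectrum_iff)
qed

lemma nonzero_spectrum_idempotent:
  fixes p :: "'a::complex_banach_algebra"
  assumes "p * p = p" "p \<noteq> 0"
  shows "nonzero_spectrum (c *\<^sub>C p) = {c} - {0}"
proof (rule set_eqI)
  fix d
  show "d \<in> nonzero_spectrum (c *\<^sub>C p) \<longleftrightarrow> d \<in> {c} - {0}"
  proof (cases "d = 0 \<or> d = c")
    case True
    then show ?thesis using assms eigenvalue_in_nonzero_spectrum[of "c *\<^sub>C p" p c]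
      by (auto simp: nonzero_spectrum_iff)
  next
    case False
    \<comment> \<open>Seeking an inverse 1 + t p of 1 - (c/d) p leaves the equation t - c/d - (c/d)
      t = 0.\<close>
    define t where "t = c / (d - c)"
    have t: "t - c / d - c / d * t = 0" using False by (simp add: t_def field_simps)
    have "(1 - inverse d *\<^sub>C (c *\<^sub>C p)) * (1 + t *\<^sub>C p) = 1 + (t - c / d - c / d * t) *\<^sub>C p"
      using assms by (simp add: algebra_simps divide_inverse)
    moreover have "(1 + t *\<^sub>C p) * (1 - inverse d *\<^sub>C (c *\<^sub>C p)) = 1 + (t - c / d - c / d * t) *\<^sub>C p"
      using assms by (simp add: algebra_simps divide_inverse)
    ultimately have "invertible_elem (1 - inverse d *\<^sub>C (c *\<^sub>C p))"
      using t by (intro invertible_elemI) simp_all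
    then show ?thesis using False by (simp add: nonzero_spectrum_iff)
  qed
qed

subsection \<open>Neumann series and continuity of inversion\<close>

lemma norm_power_Suc_le:
  fixes x :: "'a::{real_normed_algebra,ring_1}"
  shows "norm (x ^ Suc n) \<le> norm x ^ Suc n"
proof (induction n)
  case (Suc n)
  have "norm (x ^ Suc (Suc n)) \<le> norm x * norm (x ^ Suc n)"
    using norm_mult_ineq[of x "x ^ Suc n"] by simp
  also have "\<dots> \<le> norm x * norm x ^ Suc n" by (intro mult_left_mono Suc.IH) simp
  finally show ?case by simp
qed simp

text \<open>The factor \<open>max 1 (norm 1)\<close> pays for \<open>n = 0\<close>, because the norm
  of the identity is not normalized.\<close>

lemma norm_power_le:
  fixes x :: "'a::{real_normed_algebra,ring_1}"
  shows "norm (x ^ n) \<le> max 1 (norm (1::'a)) * norm x ^ n"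
proof (cases n)
  case (Suc m)
  have "1 * norm x ^ n \<le> max 1 (norm (1::'a)) * norm x ^ n"
    by (intro mult_right_mono) auto
  then show ?thesis using norm_power_Suc_le[of x m] Suc by simp
qed simp

lemma one_minus_power_factor:
  fixes x :: "'a::ring_1"
  shows "(1 - x) * (\<Sum>k<n. x ^ k) = 1 - x ^ n" "(\<Sum>k<n. x ^ k) * (1 - x) = 1 - x ^ n"
proof (induction n)
  case (Suc n)
  have "(1 - x) * (\<Sum>k<Suc n. x ^ k) = (1 - x) * (\<Sum>k<n. x ^ k) + (1 - x) * x ^ n"
    "(\<Sum>k<Suc n. x ^ k) * (1 - x) = (\<Sum>k<n. x ^ k) * (1 - x) + x ^ n * (1 - x)"
    by (simp_all add: distrib_left distrib_right)
  then show "(1 - x) * (\<Sum>k<Suc n. x ^ k) = 1 - x ^ Suc n"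
    "(\<Sum>k<Suc n. x ^ k) * (1 - x) = 1 - x ^ Suc n"
    unfolding Suc.IH by (simp_all add: left_diff_distrib right_diff_distrib power_commutes)
qed simp_all

lemma summable_power_Banach:
  fixes x :: "'a::complex_banach_algebra"
  assumes "norm x < 1" shows "summable (\<lambda>k. x ^ k)"
proof (rule summable_comparison_test)
  show "\<exists>N. \<forall>n\<ge>N. norm (x ^ n) \<le> max 1 (norm (1::'a)) * norm x ^ n"
    using norm_power_le by blast
  show "summable (\<lambda>n. max 1 (norm (1::'a)) * norm x ^ n)"
    using assms by (intro summable_mult summable_geometric) simp
qed

lemma Neumann_inverse:
  fixes x :: "'a::complex_banach_algebra"
  assumes "summable (\<lambda>k. x ^ k)"
  shows "(1 - x) * (\<Sum>k. x ^ k) = 1" "(\<Sum>k. x ^ k) * (1 - x) = 1"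
proof -
  have "(\<lambda>n. x ^ n) \<longlonglongrightarrow> 0" using assms by (rule summable_LIMSEQ_zero)
  then have 1: "(\<lambda>n. 1 - x ^ n) \<longlonglongrightarrow> 1" using tendsto_diff[OF tendsto_const] by fastforce
  have 2: "(\<lambda>n. \<Sum>k<n. x ^ k) \<longlonglongrightarrow> (\<Sum>k. x ^ k)" using assms by (rule summable_LIMSEQ)
  have "(\<lambda>n. (1 - x) * (\<Sum>k<n. x ^ k)) \<longlonglongrightarrow> (1 - x) * (\<Sum>k. x ^ k)"
    "(\<lambda>n. (\<Sum>k<n. x ^ k) * (1 - x)) \<longlonglongrightarrow> (\<Sum>k. x ^ k) * (1 - x)"
    by (intro tendsto_intros 2)+
  then show "(1 - x) * (\<Sum>k. x ^ k) = 1" "(\<Sum>k. x ^ k) * (1 - x) = 1"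
    using 1 LIMSEQ_unique unfolding one_minus_power_factor by blast+
qed

text \<open>1 - x is a commuting factor of 1 - x^n, which the Neumann series inverts.\<close>

lemma invertible_elem_one_minus_power_contraction:
  fixes x :: "'a::complex_banach_algebra"
  assumes "norm (x ^ n) < 1" "n > 0" shows "invertible_elem (1 - x)"
proof (rule invertible_elem_factor(1))
  show "invertible_elem ((1 - x) * (\<Sum>k<n. x ^ k))"
    unfolding one_minus_power_factor
    using Neumann_inverse[OF summable_power_Banach[OF assms(1)]] invertible_elemI by blast
  show "(1 - x) * (\<Sum>k<n. x ^ k) = (\<Sum>k<n. x ^ k) * (1 - x)"
    by (simp add: one_minus_power_factor)
qed

lemma invertible_elem_one_minus:
  fixes x :: "'a::complex_banach_algebra"
  assumes "norm x < 1" shows "invertible_elem (1 - x)"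
  using invertible_elem_one_minus_power_contraction[of x 1] assms by simp

definition inverse_elem :: "'a::ring_1 \<Rightarrow> 'a" where
  "inverse_elem x = (SOME y. x * y = 1 \<and> y * x = 1)"

lemma inverse_elem:
  assumes "invertible_elem x" shows "x * inverse_elem x = 1" "inverse_elem x * x = 1"
  using someI_ex[of "\<lambda>y. x * y = 1 \<and> y * x = 1"] assms
  unfolding inverse_elem_def has_two_sided_inverse_def by blast+

lemma inverse_elem_unique:
  fixes x :: "'a::ring_1"
  assumes "x * y = 1" "y * x = 1" shows "inverse_elem x = y"
proof -
  have "inverse_elem x = inverse_elem x * (x * y)" using assms by simp
  also have "\<dots> = y" using inverse_elem(2)[OF invertible_elemI[OF assms]] by (simp add: mult.assoc[symmetric])
  finally show ?thesis .
qed

lemma inverse_elem_diff: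
  fixes x y :: "'a::ring_1"
  assumes "invertible_elem x" "invertible_elem y"
  shows "inverse_elem y - inverse_elem x = inverse_elem y * (x - y) * inverse_elem x"
proof -
  have "inverse_elem y * (x - y) * inverse_elem x = inverse_elem y * (x * inverse_elem x) - (inverse_elem y * y) * inverse_elem x"
    by (simp add: algebra_simps)
  then show ?thesis using inverse_elem(1)[OF assms(1)] inverse_elem(2)[OF assms(2)] by simp
qed

lemma continuous_on_inverse_elem:
  "continuous_on {x::'a::complex_banach_algebra. invertible_elem x} inverse_elem"
  unfolding continuous_on_iff
proof (intro ballI allI impI)
  fix x :: 'a and e :: real assume x: "x \<in> {x. invertible_elem x}" and e: "e > 0"
  define B where "B = norm (inverse_elem x) + 1"
  have B: "B \<ge> 1" "norm (inverse_elem x) \<le> B" by (auto simp: B_def)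
  \<comment> \<open>The first bound keeps the norm of \<open>inverse_elem y\<close> at most 2 B; the
    second then makes the difference of inverses at most e / 2.\<close>
  define d where "d = min (1 / (2 * B)) (e / (4 * B * B))"
  show "\<exists>d>0. \<forall>x'\<in>{x. invertible_elem x}. dist x' x < d \<longrightarrow> dist (inverse_elem x') (inverse_elem x) < e"
  proof (intro exI[of _ d] conjI ballI impI)
    show "d > 0" using B e by (auto simp: d_def)
    fix y :: 'a assume y: "y \<in> {x. invertible_elem x}" and "dist y x < d"
    then have n: "norm (x - y) < d" by (simp add: dist_norm norm_minus_commute)
    have eq: "inverse_elem y - inverse_elem x = inverse_elem y * (x - y) * inverse_elem x"
      using inverse_elem_diff x y by blast
    have le: "norm (inverse_elem y - inverse_elem x) \<le> norm (inverse_elem y) * norm (x - y) * B"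
      unfolding eq
      by (meson B(2) mult_mono norm_ge_zero norm_mult_ineq order_trans mult_nonneg_nonneg order_refl)
    have "norm (x - y) * B \<le> 1 / (2 * B) * B"
      using n B by (intro mult_right_mono) (auto simp: d_def)
    then have "norm (x - y) * B \<le> 1 / 2" using B by simp
    then have "norm (inverse_elem y) * (norm (x - y) * B) \<le> norm (inverse_elem y) * (1/2)"
      by (intro mult_left_mono) auto
    then have "norm (inverse_elem y - inverse_elem x) \<le> norm (inverse_elem y) / 2" using le by (simp add: mult.assoc)
    moreover have "norm (inverse_elem y) \<le> norm (inverse_elem y - inverse_elem x) + norm (inverse_elem x)"
      using norm_triangle_sub[of "inverse_elem y" "inverse_elem x"] by simp
    ultimately have "norm (inverse_elem y) \<le> 2 * B" using B by linarith
    then have "norm (inverse_elem y) * (norm (x - y) * B) \<le> 2 * B * (norm (x - y) * B)"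
      using B by (intro mult_right_mono) auto
    with le have "norm (inverse_elem y - inverse_elem x) \<le> 2 * B * B * norm (x - y)" by (simp add: mult_ac)
    also have "\<dots> \<le> 2 * B * B * (e / (4 * B * B))"
      using n B by (intro mult_left_mono) (auto simp: d_def)
    also have "\<dots> = e / 2" using B by (simp add: field_simps)
    finally show "dist (inverse_elem y) (inverse_elem x) < e" using e by (simp add: dist_norm)
  qed
qed

lemma continuous_on_scaleC_left [continuous_intros]:
  fixes x :: "'a::complex_banach_algebra"
  assumes "continuous_on S g"
  shows "continuous_on S (\<lambda>t. g t *\<^sub>C x)"
proof -
  have "bounded_linear (\<lambda>c. c *\<^sub>C x)"
    by (rule bounded_linear_intro[of _ "norm x"])
      (simp_all add: algebra_simps scaleR_scaleC norm_scaleC scaleR_conv_of_real)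
  then show ?thesis using bounded_linear.continuous_on assms by blast
qed

subsection \<open>Elements without nonzero spectrum\<close>

text \<open>Partial fractions: 1 / (1 - y^2) is the mean of 1 / (1 - y) and 1 / (1 + y).\<close>

lemma inverse_elem_one_minus_square:
  fixes y :: "'a::complex_banach_algebra"
  assumes "invertible_elem (1 - y)" "invertible_elem (1 + y)"
  shows "invertible_elem (1 - y * y)"
    "inverse_elem (1 - y * y) = (1/2) *\<^sub>C (inverse_elem (1 - y) + inverse_elem (1 + y))"
proof -
  define W1 W2 where "W1 = inverse_elem (1 - y)" and "W2 = inverse_elem (1 + y)"
  have W1: "(1 - y) * W1 = 1" "W1 * (1 - y) = 1" and W2: "(1 + y) * W2 = 1" "W2 * (1 + y) = 1"
    using inverse_elem assms by (auto simp: W1_def W2_def)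
  have *: "(1 - y) * (1 + y) = 1 - y * y" "(1 + y) * (1 - y) = 1 - y * y"
    by (simp_all add: algebra_simps)
  have two: "(1/2) *\<^sub>C ((1 + y) + (1 - y)) = (1::'a)"
  proof -
    have "(1 + y) + (1 - y) = 1 + 1" by simp
    then show ?thesis by (simp only: scaleC_add_right scaleC_add_left[symmetric]) simp
  qed
  have "(1 - y * y) * W1 = (1 + y) * ((1 - y) * W1)" "(1 - y * y) * W2 = (1 - y) * ((1 + y) * W2)"
    by (simp_all only: * mult.assoc[symmetric])
  then have 1: "(1 - y * y) * ((1/2) *\<^sub>C (W1 + W2)) = 1"
    using two by (simp only: W1 mult_scaleC_right distrib_left W2 mult_1_right)
  have "W1 * (1 - y * y) = (W1 * (1 - y)) * (1 + y)" "W2 * (1 - y * y) = (W2 * (1 + y)) * (1 - y)"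
    by (simp_all only: * mult.assoc)
  then have 2: "((1/2) *\<^sub>C (W1 + W2)) * (1 - y * y) = 1"
    using two by (simp only: W1 mult_scaleC_left distrib_right W2 mult_1_left)
  show "invertible_elem (1 - y * y)" using 1 2 by (rule invertible_elemI)
  show "inverse_elem (1 - y * y) = (1/2) *\<^sub>C (inverse_elem (1 - y) + inverse_elem (1 + y))"
    using inverse_elem_unique[OF 1 2] by (simp add: W1_def W2_def)
qed

text \<open>
  Averaging the resolvents at the two square roots of \<open>c\<close> gives the resolvent of the square at
  \<open>c\<close>, so a bound on the unit circle survives repeated squaring.
\<close>

lemma resolvent_dist_power:
  fixes y z :: "'a::complex_banach_algebra"
  assumes "\<And>c. cmod c = 1 \<Longrightarrow> invertible_elem (1 - c *\<^sub>C y) \<and> invertible_elem (1 - c *\<^sub>C z) \<and>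
    dist (inverse_elem (1 - c *\<^sub>C y)) (inverse_elem (1 - c *\<^sub>C z)) \<le> e"
    and "cmod c = 1"
  shows "invertible_elem (1 - c *\<^sub>C y ^ 2 ^ m) \<and> invertible_elem (1 - c *\<^sub>C z ^ 2 ^ m) \<and>
    dist (inverse_elem (1 - c *\<^sub>C y ^ 2 ^ m)) (inverse_elem (1 - c *\<^sub>C z ^ 2 ^ m)) \<le> e"
  using assms(2)
proof (induction m arbitrary: c)
  case 0
  then show ?case using assms(1) by simp
next
  case (Suc m)
  define d where "d = csqrt c"
  have d: "d * d = c" "cmod d = 1" "cmod (- d) = 1"
    using Suc.prems by (simp_all add: d_def power2_eq_square[symmetric])
  define Y Z where "Y = d *\<^sub>C y ^ 2 ^ m" and "Z = d *\<^sub>C z ^ 2 ^ m"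
  have YZ: "c *\<^sub>C y ^ 2 ^ Suc m = Y * Y" "c *\<^sub>C z ^ 2 ^ Suc m = Z * Z"
    by (simp_all add: Y_def Z_def d(1)[symmetric] power_add[symmetric] mult_2)
  have inv: "invertible_elem (1 - Y)" "invertible_elem (1 + Y)" "invertible_elem (1 - Z)" "invertible_elem (1 + Z)"
    and le: "dist (inverse_elem (1 - Y)) (inverse_elem (1 - Z)) \<le> e"
      "dist (inverse_elem (1 + Y)) (inverse_elem (1 + Z)) \<le> e"
    using Suc.IH[OF d(2)] Suc.IH[OF d(3)] by (simp_all add: Y_def Z_def)
  have "dist (inverse_elem (1 - Y * Y)) (inverse_elem (1 - Z * Z)) =
    norm ((1/2) *\<^sub>C ((inverse_elem (1 - Y) - inverse_elem (1 - Z)) + (inverse_elem (1 + Y) - inverse_elem (1 + Z))))"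
    using inverse_elem_one_minus_square[OF inv(1,2)] inverse_elem_one_minus_square[OF inv(3,4)]
    by (simp add: dist_norm algebra_simps)
  also have "\<dots> \<le> (1/2) * (e + e)"
    unfolding norm_scaleC using le
    by (auto simp: dist_norm intro!: order_trans[OF norm_triangle_ineq])
  finally show ?case
    using inverse_elem_one_minus_square(1)[OF inv(1,2)] inverse_elem_one_minus_square(1)[OF inv(3,4)] YZ by simp
qed

text \<open>Only exponents 2^i occur, because repeated squaring is what the averaged resolvents
  track.\<close>

lemma power_contraction_tendsto:
  fixes y :: "'a::complex_banach_algebra"
  assumes "norm (y ^ 2 ^ m) < 1"
  shows "(\<lambda>i. y ^ 2 ^ i) \<longlonglongrightarrow> 0"
proof -
  define r where "r = norm (y ^ 2 ^ m)"
  have r: "0 \<le> r" "r < 1" using assms by (auto simp: r_def)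
  have "norm (y ^ 2 ^ (i + m)) \<le> r ^ i" for i
  proof -
    obtain j where j: "(2::nat) ^ i = Suc j" by (metis Suc_pred' zero_less_numeral zero_less_power)
    have "y ^ 2 ^ (i + m) = (y ^ 2 ^ m) ^ 2 ^ i" by (simp add: power_mult[symmetric] power_add mult.commute)
    then have "norm (y ^ 2 ^ (i + m)) \<le> r ^ 2 ^ i"
      using norm_power_Suc_le[of "y ^ 2 ^ m" j] j r_def by simp
    also have "\<dots> \<le> r ^ i" using r by (intro power_decreasing) (auto simp: less_exp less_imp_le)
    finally show ?thesis .
  qed
  then have "(\<lambda>i. y ^ 2 ^ (i + m)) \<longlonglongrightarrow> 0"
    using r by (intro Lim_null_comparison[OF _ LIMSEQ_realpow_zero[of r]]) auto
  then show ?thesis by (rule LIMSEQ_offset)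
qed

text \<open>With \<open>D\<close> = 1 - (1 - Y)^-1 one has Y = Y D - D, so norm Y * (1 - norm D) <=
  norm D; norm D < 1/2 is what turns this into norm Y < 1.\<close>

lemma norm_less_one_of_inverse_near_one:
  fixes Y :: "'a::complex_banach_algebra"
  assumes "invertible_elem (1 - Y)" "dist (inverse_elem (1 - Y)) 1 < 1/2"
  shows "norm Y < 1"
proof -
  define D where "D = 1 - inverse_elem (1 - Y)"
  have D: "norm D < 1/2" using assms(2) by (simp add: D_def dist_norm norm_minus_commute)
  have "(1 - Y) * (1 - D) = 1" using inverse_elem(1)[OF assms(1)] by (simp add: D_def)
  then have "Y = Y * D - D" by (simp add: algebra_simps)
  then have "norm Y \<le> norm (Y * D) + norm D" by (metis norm_triangle_ineq4)
  also have "\<dots> \<le> norm Y * norm D + norm D" using norm_mult_ineq by auto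
  finally have "norm Y \<le> norm Y * norm D + norm D" .
  moreover have "norm Y * norm D \<le> norm Y * (1/2)" using D by (intro mult_left_mono) auto
  ultimately show ?thesis using D by linarith
qed

text \<open>A form of the spectral radius formula. The proof follows Rickart and needs neither
  Liouville's theorem nor linear functionals: contractivity of \<open>u z\<close> propagates from \<open>u = 0\<close>
  to \<open>u = 1\<close> in finitely many steps.\<close>

lemma power_contraction_of_resolvent:
  fixes z :: "'a::complex_banach_algebra"
  assumes inv: "\<And>c. cmod c \<le> 1 \<Longrightarrow> invertible_elem (1 - c *\<^sub>C z)"
  shows "\<exists>m. norm (z ^ 2 ^ m) < 1"
proof -
  define R where "R c = inverse_elem (1 - c *\<^sub>C z)" for c
  have "continuous_on (cball 0 1) R"
    unfolding R_def
    by (intro continuous_on_compose2[OF continuous_on_inverse_elem] continuous_intros)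
      (use inv in auto)
  \<comment> \<open>Uniform continuity on the closed disk yields one step length valid along the
    whole path from 0 to z.\<close>
  then have "uniformly_continuous_on (cball 0 1) R"
    by (intro compact_uniformly_continuous) auto
  then obtain d where d: "d > 0"
    "\<And>c c'. cmod c \<le> 1 \<Longrightarrow> cmod c' \<le> 1 \<Longrightarrow> dist c' c < d \<Longrightarrow> dist (R c') (R c) < 1/4"
    unfolding uniformly_continuous_on_def by (auto dest!: spec[of _ "1/4"])
  obtain n where n: "1 / real (Suc n) < d" using nat_approx_posE[OF d(1)] by auto
  define K where "K = Suc n"
  have K: "K > 0" "1 / real K < d" using n by (simp_all add: K_def)
  define y where "y j = (of_nat j / of_nat K) *\<^sub>C z" for j
  have "\<exists>m. norm (y j ^ 2 ^ m) < 1" if "j \<le> K" for j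
    using that
  proof (induction j)
    case 0
    show ?case by (rule exI[of _ 0]) (simp add: y_def)
  next
    case (Suc j)
    then obtain m0 where "norm (y j ^ 2 ^ m0) < 1" by auto
    then have lim: "(\<lambda>i. y j ^ 2 ^ i) \<longlonglongrightarrow> 0" by (rule power_contraction_tendsto)
    have step: "invertible_elem (1 - c *\<^sub>C y j) \<and> invertible_elem (1 - c *\<^sub>C y (Suc j)) \<and>
      dist (inverse_elem (1 - c *\<^sub>C y j)) (inverse_elem (1 - c *\<^sub>C y (Suc j))) \<le> 1/4"
      if c: "cmod c = 1" for c
    proof -
      define s t where "s = c * (of_nat j / of_nat K)" and "t = c * (of_nat (Suc j) / of_nat K)"
      have st: "cmod s \<le> 1" "cmod t \<le> 1"
        using Suc.prems K c by (simp_all add: s_def t_def norm_mult norm_divide del: of_nat_Suc)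
      have "s - t = - c * (1 / of_nat K)" by (simp add: s_def t_def field_simps add_divide_distrib)
      then have "dist s t < d" using K c by (simp add: dist_norm norm_mult norm_divide)
      then have "dist (R s) (R t) < 1/4" using st d(2) by (metis dist_commute)
      then show ?thesis using inv[OF st(1)] inv[OF st(2)] by (simp add: R_def y_def s_def t_def)
    qed
    have cont: "isCont inverse_elem (1::'a)"
    proof -
      have "open (ball (1::'a) 1)" by simp
      moreover have "ball (1::'a) 1 \<subseteq> {x. invertible_elem x}"
      proof
        fix x :: 'a assume "x \<in> ball 1 1"
        then have "norm (1 - x) < 1" by (simp add: dist_norm)
        then show "x \<in> {x. invertible_elem x}" using invertible_elem_one_minus[of "1 - x"] by simp
      qed
      ultimately show ?thesis
        using continuous_on_subset[OF continuous_on_inverse_elem]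
        by (metis centre_in_ball continuous_on_eq_continuous_at[of "ball (1::'a) 1" inverse_elem] zero_less_one)
    qed
    have one: "inverse_elem (1::'a) = 1" by (rule inverse_elem_unique) auto
    have "(\<lambda>i. 1 - y j ^ 2 ^ i) \<longlonglongrightarrow> 1" using tendsto_diff[OF tendsto_const lim, of 1] by simp
    then have "(\<lambda>i. inverse_elem (1 - y j ^ 2 ^ i)) \<longlonglongrightarrow> 1"
      using isCont_tendsto_compose[OF cont] one by metis
    then have "\<forall>\<^sub>F i in sequentially. dist (inverse_elem (1 - y j ^ 2 ^ i)) 1 < 1/4"
      by (rule tendstoD) simp
    then obtain i where i: "dist (inverse_elem (1 - y j ^ 2 ^ i)) 1 < 1/4"
      by (auto simp: eventually_sequentially)
    \<comment> \<open>At c = 1, the deviation 1/4 from 1 at step j plus 1/4 between neighbours stays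
      below the threshold 1/2 of \<open>norm_less_one_of_inverse_near_one\<close>.\<close>
    have st: "invertible_elem (1 - y (Suc j) ^ 2 ^ i) \<and>
      dist (inverse_elem (1 - y j ^ 2 ^ i)) (inverse_elem (1 - y (Suc j) ^ 2 ^ i)) \<le> 1/4"
      using resolvent_dist_power[OF step, of 1 i] by simp
    then have "dist (inverse_elem (1 - y (Suc j) ^ 2 ^ i)) 1 < 1/2"
      using i dist_triangle[of "inverse_elem (1 - y (Suc j) ^ 2 ^ i)" 1 "inverse_elem (1 - y j ^ 2 ^ i)"]
      by (simp add: dist_commute)
    then show ?case using norm_less_one_of_inverse_near_one st by blast
  qed
  from this[of K] K show ?thesis by (simp add: y_def)
qed

lemma nonzero_spectrum_emptyD:
  fixes z :: "'a::complex_banach_algebra"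
  assumes "nonzero_spectrum z = {}"
  shows "invertible_elem (1 - c *\<^sub>C z)"
proof (cases "c = 0")
  case True
  then show ?thesis using invertible_elemI[of 1 1] by simp
next
  case False
  then show ?thesis using assms nonzero_spectrum_iff[of "inverse c" z] by auto
qed

text \<open>Reduce exponents modulo M: the remainder leaves finitely many factors, the quotient a
  power of a contraction.\<close>

lemma power_bounded_of_contraction:
  fixes y :: "'a::complex_banach_algebra"
  assumes "norm (y ^ M) < 1" "M > 0"
  shows "\<exists>B. \<forall>n. norm (y ^ n) \<le> B"
proof -
  define C where "C = (\<Sum>r<M. norm (y ^ r))"
  have "norm (y ^ n) \<le> C * max 1 (norm (1::'a))" for n
  proof -
    have "y ^ n = y ^ (n mod M) * (y ^ M) ^ (n div M)"
      by (simp add: power_mult[symmetric] power_add[symmetric])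
    then have "norm (y ^ n) \<le> norm (y ^ (n mod M)) * norm ((y ^ M) ^ (n div M))"
      using norm_mult_ineq by metis
    also have "\<dots> \<le> C * max 1 (norm (1::'a))"
    proof (rule mult_mono)
      show "norm (y ^ (n mod M)) \<le> C"
        unfolding C_def by (intro member_le_sum) (use assms in auto)
      have "norm ((y ^ M) ^ (n div M)) \<le> max 1 (norm (1::'a)) * norm (y ^ M) ^ (n div M)"
        by (rule norm_power_le)
      also have "\<dots> \<le> max 1 (norm (1::'a)) * 1"
        using assms(1) by (intro mult_left_mono power_le_one) auto
      finally show "norm ((y ^ M) ^ (n div M)) \<le> max 1 (norm (1::'a))" by simp
    qed (auto simp: C_def intro: sum_nonneg)
    finally show ?thesis .
  qed
  then show ?thesis by blast
qed

lemma scaleC_power: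
  fixes x :: "'a::complex_banach_algebra"
  shows "(c *\<^sub>C x) ^ n = c ^ n *\<^sub>C x ^ n"
  by (induction n) (simp_all add: mult.commute)

text \<open>Rescaling by 1 / e keeps the nonzero spectrum empty, so some power of z / e
  contracts.\<close>

lemma quasinilpotent_power_bound:
  fixes z :: "'a::complex_banach_algebra"
  assumes "nonzero_spectrum z = {}" "e > 0"
  shows "\<exists>B\<ge>0. \<forall>n. norm (z ^ n) \<le> B * e ^ n"
proof -
  define t :: complex where "t = of_real (1 / e)"
  have "invertible_elem (1 - c *\<^sub>C (t *\<^sub>C z))" for c
    using nonzero_spectrum_emptyD[OF assms(1)] by simp
  then obtain m where "norm ((t *\<^sub>C z) ^ 2 ^ m) < 1"
    using power_contraction_of_resolvent by blast
  then obtain B where B: "\<And>n. norm ((t *\<^sub>C z) ^ n) \<le> B"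
    using power_bounded_of_contraction[of "t *\<^sub>C z"] by (metis zero_less_numeral zero_less_power)
  have "norm (z ^ n) \<le> B * e ^ n" for n
  proof -
    have "norm (z ^ n) / e ^ n \<le> B"
      using B[of n] assms(2)
      by (simp add: scaleC_power norm_scaleC norm_power t_def power_divide norm_divide)
    then show ?thesis using assms(2) by (simp add: pos_divide_le_eq)
  qed
  moreover have "B \<ge> 0" using B[of 0] norm_ge_zero order_trans by blast
  ultimately show ?thesis by blast
qed

lemma power_mult_distrib_commute:
  fixes x y :: "'a::ring_1"
  assumes "x * y = y * x"
  shows "(x * y) ^ n = x ^ n * y ^ n"
proof (induction n)
  case (Suc n)
  have "y * x ^ n = x ^ n * y" using power_commuting_commutes[OF assms, of n] by simp
  then have "x * (y * x ^ n) * y ^ n = x * (x ^ n * y) * y ^ n" by simp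
  then show ?case using Suc by (simp add: mult.assoc)
qed simp

text \<open>Commutation gives norm ((h z)^n) <= norm (h^n) * norm (z^n), and the decay of z^n at any
  prescribed rate beats the growth of h^n.\<close>

lemma nonzero_spectrum_mult_quasinilpotent:
  fixes h z :: "'a::complex_banach_algebra"
  assumes z: "nonzero_spectrum z = {}" and "h * z = z * h"
  shows "nonzero_spectrum (h * z) = {}"
proof -
  have "invertible_elem (1 - c *\<^sub>C (h * z))" for c
  proof -
    define h' where "h' = c *\<^sub>C h"
    have comm: "h' * z = z * h'" using assms by (simp add: h'_def)
    define K where "K = max 1 (norm (1::'a))"
    \<comment> \<open>Makes e * norm h' at most 1/2; the added 1 avoids division by zero.\<close>
    define e where "e = 1 / (2 * (norm h' + 1))"
    have e: "e > 0" "e * norm h' \<le> 1/2" using norm_ge_zero[of h'] unfolding e_def by (auto simp: field_simps add_pos_nonneg)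
    obtain B where B: "B \<ge> 0" "\<And>n. norm (z ^ n) \<le> B * e ^ n"
      using quasinilpotent_power_bound[OF z e(1)] by blast
    have K: "K \<ge> 0" by (auto simp: K_def)
    have *: "norm ((h' * z) ^ n) \<le> K * B * (1/2) ^ n" for n
    proof -
      have "norm ((h' * z) ^ n) \<le> norm (h' ^ n) * norm (z ^ n)"
        using power_mult_distrib_commute[OF comm] norm_mult_ineq by metis
      also have "\<dots> \<le> (K * norm h' ^ n) * (B * e ^ n)"
        using K B by (intro mult_mono) (auto simp: K_def norm_power_le)
      also have "\<dots> = K * B * (e * norm h') ^ n" by (simp add: power_mult_distrib)
      also have "\<dots> \<le> K * B * (1/2) ^ n" using K B e by (intro mult_left_mono power_mono) auto
      finally show ?thesis .
    qed
    have "(\<lambda>n. K * B * (1/2) ^ n) \<longlonglongrightarrow> K * B * 0"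
      by (intro tendsto_intros LIMSEQ_realpow_zero) auto
    then have "\<forall>\<^sub>F n in sequentially. K * B * (1/2) ^ n < 1"
      by (intro order_tendstoD(2)) auto
    then obtain n where "n > 0" "K * B * (1/2) ^ n < 1"
      unfolding eventually_sequentially by (metis le_SucI order_refl zero_less_Suc)
    then have "norm ((h' * z) ^ n) < 1" using *[of n] by linarith
    then have "invertible_elem (1 - h' * z)"
      using \<open>n > 0\<close> by (rule invertible_elem_one_minus_power_contraction)
    then show ?thesis by (simp add: h'_def)
  qed
  then show ?thesis by (auto simp: nonzero_spectrum_iff)
qed

text \<open>Since w commutes with z, their product p again has no nonzero spectrum, whereas a
  nonzero idempotent has spectral value 1.\<close>

lemma quasinilpotent_unit_in_corner:
  fixes p z w :: "'a::complex_banach_algebra"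
  assumes "p * p = p" "w * z = p" "z * w = p" "nonzero_spectrum z = {}"
  shows "p = 0"
  using nonzero_spectrum_mult_quasinilpotent[OF assms(4), of w] assms
    nonzero_spectrum_idempotent[of p 1] by auto

subsection \<open>Semisimplicity\<close>

text \<open>Every later appeal to semisimplicity passes through this criterion. If y were outside a
  maximal left ideal L, then L + A y = A would put an invertible element 1 - z y into L.\<close>

lemma semisimple_eq_zero:
  fixes y :: "'a::complex_banach_algebra"
  assumes "semisimple TYPE('a)" and inv: "\<And>z. nonzero_spectrum (z * y) = {}"
  shows "y = 0"
proof -
  have "y \<in> L" if L: "maximal_left_ideal L" for L
  proof (rule ccontr)
    assume "y \<notin> L"
    have li: "left_ideal L" and ne: "L \<noteq> UNIV"
      and max: "\<And>M. left_ideal M \<Longrightarrow> L \<subseteq> M \<Longrightarrow> M = L \<or> M = UNIV"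
      using L unfolding maximal_left_ideal_def by auto
    define M where "M = {l + z * y |l z. l \<in> L}"
    have "left_ideal M"
      unfolding left_ideal_def
    proof (intro conjI ballI allI)
      show "0 \<in> M" unfolding M_def using li by (auto simp: left_ideal_def intro!: exI[of _ 0])
    next
      fix u v assume "u \<in> M" "v \<in> M"
      then obtain l z l' z' where "u = l + z * y" "v = l' + z' * y" "l \<in> L" "l' \<in> L"
        unfolding M_def by blast
      moreover from this have "u + v = (l + l') + (z + z') * y" by (simp add: algebra_simps)
      ultimately show "u + v \<in> M" unfolding M_def using li unfolding left_ideal_def by blast
    next
      fix a u assume "u \<in> M"
      then obtain l z where "u = l + z * y" "l \<in> L" unfolding M_def by blast
      moreover from this have "a * u = a * l + (a * z) * y" by (simp add: algebra_simps)
      ultimately show "a * u \<in> M" unfolding M_def using li unfolding left_ideal_def by blast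
    qed
    moreover have "L \<subseteq> M"
    proof
      fix l assume "l \<in> L"
      then have "l = l + 0 * y \<and> l \<in> L" by simp
      then show "l \<in> M" unfolding M_def by blast
    qed
    moreover have "y \<in> M"
    proof -
      have "y = 0 + 1 * y \<and> 0 \<in> L" using li by (simp add: left_ideal_def)
      then show ?thesis unfolding M_def by blast
    qed
    ultimately have "M = UNIV" using max \<open>y \<notin> L\<close> by blast
    then obtain l z where lz: "1 = l + z * y" "l \<in> L" unfolding M_def by blast
    have "invertible_elem (1 - 1 *\<^sub>C (z * y))" by (rule nonzero_spectrum_emptyD[OF inv])
    then have "invertible_elem l" using lz(1) by (metis add_diff_cancel_right' scaleC_one)
    then obtain w where "w * l = 1" unfolding has_two_sided_inverse_def by blast
    then have "1 \<in> L" using lz(2) li unfolding left_ideal_def by metis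
    then have "L = UNIV" using li unfolding left_ideal_def by (metis UNIV_eq_I mult.right_neutral)
    then show False using ne by blast
  qed
  then have "y \<in> jacobson_radical" unfolding jacobson_radical_def by blast
  then show ?thesis using assms(1) unfolding semisimple_def by blast
qed

subsection \<open>Polynomials in an element of the algebra\<close>

definition aeval :: "complex poly \<Rightarrow> 'a::complex_banach_algebra \<Rightarrow> 'a" where
  "aeval G x = fold_coeffs (\<lambda>c y. c *\<^sub>C 1 + x * y) G 0"

lemma aeval_0 [simp]: "aeval 0 x = 0"
  by (simp add: aeval_def)

lemma aeval_pCons [simp]: "aeval (pCons c G) x = c *\<^sub>C 1 + x * aeval G x"
  by (cases "c = 0 \<and> G = 0") (auto simp: aeval_def)

lemma aeval_add [simp]: "aeval (G + H) x = aeval G x + aeval H x"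
  by (induction G H rule: poly_induct2) (simp_all add: algebra_simps)

lemma aeval_smult [simp]: "aeval (smult c G) x = c *\<^sub>C aeval G x"
  by (induction G) (simp_all add: algebra_simps)

lemma aeval_diff [simp]: "aeval (G - H) x = aeval G x - aeval H x"
proof -
  have "G - H = G + smult (- 1) H" by simp
  then show ?thesis by (simp only: aeval_add aeval_smult) simp
qed

lemma aeval_mult [simp]: "aeval (G * H) x = aeval G x * aeval H x"
  by (induction G) (simp_all add: algebra_simps)

lemma aeval_sum: "aeval (sum G I) x = (\<Sum>i\<in>I. aeval (G i) x)"
  by (induction I rule: infinite_finite_induct) simp_all

lemma aeval_commute:
  assumes "y * x = x * y" shows "y * aeval G x = aeval G x * y"
proof (induction G)
  case (pCons c G)
  have "y * (x * aeval G x) = x * (y * aeval G x)" using assms by (metis mult.assoc)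
  also have "\<dots> = x * aeval G x * y" by (simp add: pCons.IH mult.assoc)
  finally show ?case by (simp add: distrib_left distrib_right)
qed simp

text \<open>G splits into linear factors over the complex numbers, and each is invertible at x
  because its root lies outside the spectrum.\<close>

lemma invertible_elem_aeval:
  fixes x :: "'a::complex_banach_algebra"
  assumes "G \<noteq> 0" "\<And>c. c \<in> spectrum x \<Longrightarrow> poly G c \<noteq> 0"
  shows "invertible_elem (aeval G x)"
  using assms
proof (induction "degree G" arbitrary: G)
  case 0
  then obtain c where "G = [:c:]" by (metis degree_eq_zeroE)
  then show ?case using 0 invertible_elem_scaleC[of c "1::'a"] invertible_elemI[of "1::'a" 1] by simp
next
  case (Suc n)
  then have "\<not> constant (poly G)" by (simp add: constant_degree)
  then obtain c where c: "poly G c = 0" using fundamental_theorem_of_algebra by blast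
  then obtain H where H: "G = [:- c, 1:] * H" using poly_eq_0_iff_dvd by (metis dvdE)
  have "invertible_elem (c *\<^sub>C 1 - x)" using Suc.prems(2) c unfolding spectrum_def by blast
  then have "invertible_elem ((- 1) *\<^sub>C (c *\<^sub>C 1 - x))" by (subst invertible_elem_scaleC) auto
  then have 1: "invertible_elem (aeval [:- c, 1:] x)" by (simp add: algebra_simps)
  have "H \<noteq> 0" using H Suc.prems(1) by auto
  moreover have "degree G = Suc (degree H)"
    unfolding H using \<open>H \<noteq> 0\<close> by (subst degree_mult_eq) auto
  ultimately have "invertible_elem (aeval H x)"
    using Suc H by (intro Suc.hyps(1)) auto
  then show ?case using 1 invertible_elem_mult unfolding H aeval_mult by blast
qed

text \<open>For nonzero d the polynomial d - G has no zero on the spectrum. Including 0 guarantees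
  that d - G is not the zero polynomial even if the spectrum were empty.\<close>

lemma nonzero_spectrum_aeval_empty:
  assumes "\<And>c. c \<in> insert 0 (spectrum x) \<Longrightarrow> poly G c = 0"
  shows "nonzero_spectrum (aeval G x) = {}"
proof -
  have "invertible_elem (d *\<^sub>C 1 - aeval G x)" if "d \<noteq> 0" for d
  proof -
    have 0: "poly ([:d:] - G) 0 \<noteq> 0" using assms[of 0] that by simp
    have "invertible_elem (aeval ([:d:] - G) x)"
    proof (rule invertible_elem_aeval)
      show "[:d:] - G \<noteq> 0" using 0 by (metis poly_0)
      show "poly ([:d:] - G) c \<noteq> 0" if "c \<in> spectrum x" for c
        using assms[of c] that \<open>d \<noteq> 0\<close> by simp
    qed
    then show ?thesis by simp
  qed
  then show ?thesis unfolding nonzero_spectrum_def spectrum_def by auto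
qed

text \<open>X - c divides G(c) - G with a commuting cofactor, so an inverse of G(c) - G(x) would
  make c - x invertible.\<close>

lemma spectrum_aeval_mem:
  assumes "c \<in> spectrum x" shows "poly G c \<in> spectrum (aeval G x)"
proof -
  have "poly ([:poly G c:] - G) c = 0" by simp
  then obtain H where H: "[:poly G c:] - G = [:- c, 1:] * H" by (metis poly_eq_0_iff_dvd dvdE)
  then have "aeval ([:poly G c:] - G) x = aeval [:- c, 1:] x * aeval H x"
    "aeval [:- c, 1:] x * aeval H x = aeval H x * aeval [:- c, 1:] x"
    by (simp_all only: aeval_mult[symmetric] mult.commute)
  moreover have "aeval [:- c, 1:] x = (- 1) *\<^sub>C (c *\<^sub>C 1 - x)" by (simp add: algebra_simps)
  ultimately have eq: "poly G c *\<^sub>C 1 - aeval G x = ((- 1) *\<^sub>C (c *\<^sub>C 1 - x)) * aeval H x"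
    "((- 1) *\<^sub>C (c *\<^sub>C 1 - x)) * aeval H x = aeval H x * ((- 1) *\<^sub>C (c *\<^sub>C 1 - x))"
    by auto
  show ?thesis
  proof (rule ccontr)
    assume "poly G c \<notin> spectrum (aeval G x)"
    then have "invertible_elem (poly G c *\<^sub>C 1 - aeval G x)" unfolding spectrum_def by blast
    then have "invertible_elem ((- 1) *\<^sub>C (c *\<^sub>C 1 - x))"
      unfolding eq(1) using eq(2) by (rule invertible_elem_factor(1))
    then have "invertible_elem (c *\<^sub>C 1 - x)" by (subst (asm) invertible_elem_scaleC) auto
    then show False using assms unfolding spectrum_def by blast
  qed
qed

lemma Lagrange_basis_polynomial:
  fixes c :: complex
  assumes "finite K"
  shows "\<exists>G. poly G c = 1 \<and> (\<forall>k\<in>K - {c}. poly G k = 0)"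
proof -
  define G where "G = (\<Prod>k\<in>K - {c}. smult (1 / (c - k)) [:- k, 1:])"
  have "poly G c = 1" unfolding G_def poly_prod by (intro prod.neutral) (auto simp flip: diff_divide_distrib)
  moreover have "poly G k = 0" if "k \<in> K - {c}" for k
    unfolding G_def poly_prod using that assms by (intro prod_zero) auto
  ultimately show ?thesis by blast
qed

subsection \<open>Lifting idempotents modulo quasinilpotents\<close>

text \<open>\<open>sqrt_coeff k\<close> is the \<open>k\<close>-th Taylor coefficient of \<open>(1 - 4 t) powr (- 1/2)\<close>.\<close>

definition sqrt_coeff :: "nat \<Rightarrow> complex" where
  "sqrt_coeff k = (- 4) ^ k * ((- 1/2) gchoose k)"

text \<open>Squaring the series of (1 - 4 t)^(-1/2) gives the geometric series of 4 t; on
  coefficients this is Vandermonde's identity for -1/2 + -1/2 = -1.\<close>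

lemma sqrt_coeff_convolution: "(\<Sum>i\<le>n. sqrt_coeff i * sqrt_coeff (n - i)) = 4 ^ n"
proof -
  have m1: "((- 1) gchoose n) = (- 1 :: complex) ^ n"
    using gbinomial_minus[of "1::complex" n] by (simp add: binomial_gbinomial[symmetric])
  have "(\<Sum>i\<le>n. sqrt_coeff i * sqrt_coeff (n - i)) =
    (\<Sum>i\<le>n. (- 4) ^ n * (((- 1/2) gchoose i) * ((- 1/2) gchoose (n - i))))"
  proof (rule sum.cong)
    fix i assume "i \<in> {..n}"
    then have "(- 4 :: complex) ^ n = (- 4) ^ i * (- 4) ^ (n - i)" by (simp flip: power_add)
    then show "sqrt_coeff i * sqrt_coeff (n - i) =
      (- 4) ^ n * (((- 1/2) gchoose i) * ((- 1/2) gchoose (n - i)))"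
      by (simp add: sqrt_coeff_def)
  qed simp
  also have "\<dots> = (- 4) ^ n * ((- 1/2 + - 1/2 :: complex) gchoose n)"
    by (simp add: sum_distrib_left[symmetric] gbinomial_Vandermonde atMost_atLeast0)
  also have "\<dots> = (- 4) ^ n * (- 1) ^ n" using m1 by simp
  also have "\<dots> = 4 ^ n" by (simp flip: power_mult_distrib)
  finally show ?thesis .
qed

lemma norm_sqrt_coeff_le: "norm (sqrt_coeff k) \<le> 4 ^ k"
proof -
  have "norm ((- 1/2 :: complex) gchoose k) \<le> 1"
  proof -
    have "norm ((- 1/2 :: complex) gchoose k) = norm (\<Prod>i = 0..<k. - 1/2 - of_nat i :: complex) / fact k"
      unfolding gbinomial_prod_rev by (simp add: norm_divide)
    also have "norm (\<Prod>i = 0..<k. - 1/2 - of_nat i :: complex) \<le> (\<Prod>i = 0..<k. real (Suc i))"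
      unfolding prod_norm[symmetric]
    proof (intro prod_mono conjI)
      fix i
      have "norm (- 1/2 - of_nat i :: complex) \<le> norm (- 1/2 :: complex) + norm (of_nat i :: complex)"
        by (rule norm_triangle_ineq4)
      then show "norm (- 1/2 - of_nat i :: complex) \<le> real (Suc i)" by simp
    qed auto
    also have "(\<Prod>i = 0..<k. real (Suc i)) = fact k"
      by (induction k) (simp_all add: mult.commute)
    finally show ?thesis by (simp add: divide_right_mono)
  qed
  then have "4 ^ k * norm ((- 1/2 :: complex) gchoose k) \<le> 4 ^ k * 1" by (intro mult_left_mono) auto
  then show ?thesis by (simp add: sqrt_coeff_def norm_mult norm_power)
qed

lemma inverse_elem_commute:
  fixes x y :: "'a::ring_1"
  assumes "invertible_elem x" "y * x = x * y"
  shows "y * inverse_elem x = inverse_elem x * y"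
proof -
  note i = inverse_elem[OF assms(1)]
  have "inverse_elem x * (y * x) * inverse_elem x = inverse_elem x * (x * y) * inverse_elem x"
    using assms(2) by simp
  then have "inverse_elem x * y * (x * inverse_elem x) = (inverse_elem x * x) * y * inverse_elem x"
    by (simp only: mult.assoc)
  then show ?thesis by (simp add: i)
qed

text \<open>Here s is (1 - 4 q)^(-1/2) as a convergent series, and t is the shifted series (s - 1) /
  q, kept so that s visibly differs from 1 by a multiple of q.\<close>

lemma inverse_sqrt_series:
  fixes q :: "'a::complex_banach_algebra"
  assumes q: "nonzero_spectrum q = {}"
  obtains s t where "s * s * (1 - 4 *\<^sub>C q) = 1" "s = 1 + q * t"
    "\<And>y. y * q = q * y \<Longrightarrow> y * s = s * y" "\<And>y. y * q = q * y \<Longrightarrow> y * t = t * y"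
proof -
  \<comment> \<open>Coefficients grow at most like 4^n, so the rate 1/8 leaves ratio 1/2; the spare
    factor 4 in the bounds below absorbs the index shift of t.\<close>
  obtain B where B: "B \<ge> 0" "\<And>n. norm (q ^ n) \<le> B * (1/8) ^ n"
    using quasinilpotent_power_bound[OF q, of "1/8"] by auto
  have geo: "norm (c *\<^sub>C q ^ n) \<le> 4 * B * (1/2) ^ n" if "norm c \<le> 4 * 4 ^ n" for c n
  proof -
    have "norm (c *\<^sub>C q ^ n) \<le> (4 * 4 ^ n) * (B * (1/8) ^ n)"
      unfolding norm_scaleC using B that by (intro mult_mono) auto
    also have "\<dots> = 4 * B * ((4 * (1/8)) ^ n)" by (simp only: power_mult_distrib mult_ac)
    finally show ?thesis by simp
  qed
  have summable: "summable (\<lambda>n. norm (c n *\<^sub>C q ^ n))" if "\<And>n. norm (c n) \<le> 4 * 4 ^ n" for c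
    by (rule summable_comparison_test[of _ "\<lambda>n. 4 * B * (1/2) ^ n"])
      (use geo that in \<open>auto intro!: summable_mult summable_geometric\<close>)
  have c1: "norm (sqrt_coeff n) \<le> 4 * 4 ^ n" for n
    by (rule order_trans[OF norm_sqrt_coeff_le]) simp
  have c2: "norm (sqrt_coeff (Suc n)) \<le> 4 * 4 ^ n" for n
    using norm_sqrt_coeff_le[of "Suc n"] by simp
  have c3: "norm (4 ^ n :: complex) \<le> 4 * 4 ^ n" for n by (simp add: norm_power)
  define s t where "s = (\<Sum>n. sqrt_coeff n *\<^sub>C q ^ n)" and "t = (\<Sum>n. sqrt_coeff (Suc n) *\<^sub>C q ^ n)"
  note sum1 = summable_norm_cancel[OF summable[OF c1]] and sum2 = summable_norm_cancel[OF summable[OF c2]]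
  have comm: "y * (\<Sum>n. c n *\<^sub>C q ^ n) = (\<Sum>n. c n *\<^sub>C q ^ n) * y"
    if "y * q = q * y" "summable (\<lambda>n. c n *\<^sub>C q ^ n)" for y c
  proof -
    have "y * (c n *\<^sub>C q ^ n) = (c n *\<^sub>C q ^ n) * y" for n
      using power_commuting_commutes[of q y n] that by simp
    then have "(\<Sum>n. y * (c n *\<^sub>C q ^ n)) = (\<Sum>n. (c n *\<^sub>C q ^ n) * y)" by (simp only:)
    then show ?thesis using suminf_mult[OF that(2), of y] suminf_mult2[OF that(2), of y] by metis
  qed
  have "s * s = (\<Sum>n. \<Sum>i\<le>n. (sqrt_coeff i *\<^sub>C q ^ i) * (sqrt_coeff (n - i) *\<^sub>C q ^ (n - i)))"
    unfolding s_def by (intro Cauchy_product summable c1)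
  also have "\<dots> = (\<Sum>n. (4 *\<^sub>C q) ^ n)"
  proof (rule suminf_cong)
    fix n
    have "(\<Sum>i\<le>n. (sqrt_coeff i *\<^sub>C q ^ i) * (sqrt_coeff (n - i) *\<^sub>C q ^ (n - i))) =
      (\<Sum>i\<le>n. (sqrt_coeff i * sqrt_coeff (n - i)) *\<^sub>C q ^ n)"
      by (rule sum.cong) (simp_all flip: power_add add: mult.commute)
    then show "(\<Sum>i\<le>n. (sqrt_coeff i *\<^sub>C q ^ i) * (sqrt_coeff (n - i) *\<^sub>C q ^ (n - i))) = (4 *\<^sub>C q) ^ n"
      by (simp add: scaleC.scale_sum_left[symmetric] sqrt_coeff_convolution scaleC_power)
  qed
  finally have "s * s * (1 - 4 *\<^sub>C q) = 1"
    using Neumann_inverse(2)[of "4 *\<^sub>C q"] summable_norm_cancel[OF summable[OF c3]] by (simp add: scaleC_power)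
  moreover have "s = 1 + q * t"
  proof -
    have "s = (\<Sum>n. sqrt_coeff (Suc n) *\<^sub>C q ^ Suc n) + sqrt_coeff 0 *\<^sub>C q ^ 0"
      using suminf_split_head[OF sum1] by (simp add: s_def)
    also have "(\<Sum>n. sqrt_coeff (Suc n) *\<^sub>C q ^ Suc n) = q * t"
      unfolding t_def using suminf_mult[OF sum2, of q] by simp
    finally show ?thesis by (simp add: sqrt_coeff_def)
  qed
  ultimately show ?thesis using that comm[OF _ sum1] comm[OF _ sum2] unfolding s_def t_def by blast
qed

text \<open>(2 e - 1)^2 = 1 - 4 (e - e^2), so dividing 2 e - 1 by the square root of the right side
  gives an involution D s, and (1 + D s) / 2 is idempotent. The factor h keeps p in every left ideal
  containing e.\<close>

lemma idempotent_lift: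
  fixes e :: "'a::complex_banach_algebra"
  assumes q: "nonzero_spectrum (e - e * e) = {}"
  obtains p h where "p * p = p" "nonzero_spectrum (p - e) = {}" "p = h * e"
    "\<And>y. y * e = e * y \<Longrightarrow> y * h = h * y"
proof -
  define q where "q = e - e * e"
  obtain s t where s: "s * s * (1 - 4 *\<^sub>C q) = 1" "s = 1 + q * t"
    and comm: "\<And>y. y * q = q * y \<Longrightarrow> y * s = s * y" "\<And>y. y * q = q * y \<Longrightarrow> y * t = t * y"
    using inverse_sqrt_series[of q] assms q_def by blast
  have commq: "y * q = q * y" if "y * e = e * y" for y
    unfolding q_def using that by (simp add: algebra_simps) (metis mult.assoc)
  define D where "D = e + e - 1"
  have commD: "y * D = D * y" if "y * e = e * y" for y
    unfolding D_def using that by (simp add: algebra_simps)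
  have four: "4 *\<^sub>C x = x + x + x + x" for x :: 'a
  proof -
    have "(4::complex) = 1 + 1 + 1 + 1" by simp
    then show ?thesis by (simp only: scaleC_add_left scaleC_one)
  qed
  have DD: "D * D = 1 - 4 *\<^sub>C q" unfolding four by (simp add: D_def q_def algebra_simps)
  have Ds: "D * s = s * D" by (intro comm(1) commq) (simp add: D_def algebra_simps)
  have half: "(1/2) *\<^sub>C (x + x) = x" for x :: 'a
    by (simp only: scaleC_add_right scaleC_add_left[symmetric]) simp
  define p where "p = (1/2) *\<^sub>C (1 + D * s)"
  have "(D * s) * (D * s) = s * s * (D * D)"
    using Ds by (metis mult.assoc)
  then have DsDs: "(D * s) * (D * s) = 1" using s DD by simp
  have pp: "p * p = p"
  proof -
    have "(1 + D * s) * (1 + D * s) = (1 + D * s) + (1 + D * s)"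
      using DsDs by (simp only: distrib_left distrib_right mult_1_left mult_1_right add_ac)
    then have "p * p = (1/2) *\<^sub>C ((1/2) *\<^sub>C ((1 + D * s) + (1 + D * s)))"
      unfolding p_def mult_scaleC_left mult_scaleC_right by simp
    then show ?thesis by (simp only: half p_def)
  qed
  have pe: "p - e = ((1/2) *\<^sub>C (D * t)) * q"
  proof -
    have tq: "q * t = t * q" by (rule comm) simp
    have "1 + D * s = (e + e) + D * t * q"
      unfolding s(2) tq by (simp add: D_def algebra_simps)
    then have "p = e + (1/2) *\<^sub>C (D * t * q)"
      unfolding p_def by (simp only: scaleC_add_right[of "1/2" "e + e"] half)
    then show ?thesis by simp
  qed
  have commp: "y * p = p * y" if "y * e = e * y" for y
  proof -
    have "y * (D * s) = (D * s) * y" using commD[OF that] comm(1)[OF commq[OF that]] by (metis mult.assoc)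
    then show ?thesis by (simp add: p_def algebra_simps)
  qed
  have commw: "y * (p - e) = (p - e) * y" if "y * e = e * y" for y
    using commp[OF that] that by (simp add: algebra_simps)
  have "((1/2) *\<^sub>C (D * t)) * q = q * ((1/2) *\<^sub>C (D * t))"
  proof -
    have "D * t * q = q * (D * t)" using commq[of D] commD[of e] comm(2)[of q] by (metis mult.assoc)
    then show ?thesis by simp
  qed
  then have qn: "nonzero_spectrum (p - e) = {}"
    unfolding pe using assms q_def by (intro nonzero_spectrum_mult_quasinilpotent) auto
  then have inv: "invertible_elem (1 - (p - e))" using nonzero_spectrum_emptyD[of "p - e" 1] by simp
  define v where "v = inverse_elem (1 - (p - e))"
  have commv: "y * v = v * y" if "y * e = e * y" for y
    unfolding v_def using commw[OF that] by (intro inverse_elem_commute[OF inv]) (simp add: algebra_simps)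
  \<comment> \<open>Idempotence of p cancels everything but p e; inverting 1 - (p - e) then exhibits
    p as a multiple of e.\<close>
  have "p * (1 - (p - e)) = p * e" using pp by (simp add: algebra_simps)
  then have "p * (1 - (p - e)) * v = p * e * v" by simp
  then have "p = p * e * v" using inverse_elem(1)[OF inv] by (simp add: mult.assoc v_def)
  also have "\<dots> = (p * v) * e" using commv[of e] by (simp add: mult.assoc)
  finally have "p = (p * v) * e" .
  moreover have "y * (p * v) = (p * v) * y" if "y * e = e * y" for y
    using commp[OF that] commv[OF that] by (metis mult.assoc)
  ultimately show ?thesis using that pp qn by blast
qed

text \<open>Lagrange polynomials at b are idempotent and mutually orthogonal up to errors without
  nonzero spectrum; lifting makes both relations exact.\<close>

lemma spectral_idempotents:
  fixes b :: "'a::complex_banach_algebra"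
  assumes fin: "finite (spectrum b)"
  obtains P where "\<And>c. c \<in> nonzero_spectrum b \<Longrightarrow> P c * P c = P c"
    "\<And>c. c \<in> nonzero_spectrum b \<Longrightarrow> P c \<noteq> 0"
    "\<And>c. c \<in> nonzero_spectrum b \<Longrightarrow> \<exists>h. P c = h * b"
    "\<And>c. c \<in> nonzero_spectrum b \<Longrightarrow> P c * b = b * P c"
    "\<And>c d. c \<in> nonzero_spectrum b \<Longrightarrow> d \<in> nonzero_spectrum b \<Longrightarrow> c \<noteq> d \<Longrightarrow> P c * P d = 0"
proof -
  define K where "K = insert 0 (spectrum b)"
  have "\<exists>G. poly G c = 1 \<and> (\<forall>k\<in>K - {c}. poly G k = 0)" for c
    using Lagrange_basis_polynomial fin K_def by blast
  then obtain G where G: "\<And>c. poly (G c) c = 1" "\<And>c k. k \<in> K - {c} \<Longrightarrow> poly (G c) k = 0"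
    by metis
  define e where "e c = aeval (G c) b" for c
  have "\<exists>p h. p * p = p \<and> nonzero_spectrum (p - e c) = {} \<and> p = h * e c \<and>
      (\<forall>y. y * e c = e c * y \<longrightarrow> y * h = h * y)" for c
  proof -
    have "nonzero_spectrum (aeval (G c - G c * G c) b) = {}"
      using G by (intro nonzero_spectrum_aeval_empty) (metis DiffI K_def diff_self mult_1 mult_zero_left poly_diff poly_mult singletonD)
    then have "nonzero_spectrum (e c - e c * e c) = {}" by (simp add: e_def)
    then show ?thesis by (rule idempotent_lift) blast
  qed
  then obtain P H where P: "\<And>c. P c * P c = P c" "\<And>c. nonzero_spectrum (P c - e c) = {}"
    "\<And>c. P c = H c * e c" "\<And>c y. y * e c = e c * y \<Longrightarrow> y * H c = H c * y"
    by metis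
  have be: "b * e c = e c * b" for c unfolding e_def by (rule aeval_commute) simp
  have ee: "e c * e d = e d * e c" for c d
    unfolding e_def by (simp only: aeval_mult[symmetric] mult.commute)
  have bH: "b * H c = H c * b" for c using P(4) be by blast
  have eH: "e d * H c = H c * e d" for c d using P(4) ee by blast
  have HH: "H d * H c = H c * H d" for c d using P(4) eH by metis
  \<comment> \<open>The product is idempotent, and it is a commuting multiple of
    \<open>e c * e d\<close>, whose polynomial vanishes on K; so it has no nonzero spectrum and must
    be 0.\<close>
  have orth: "P c * P d = 0" if "c \<noteq> d" for c d
  proof -
    have PP: "P c * P d = (H c * H d) * (e c * e d)"
      unfolding P(3)[of c] P(3)[of d] using eH by (metis mult.assoc)
    have "P c * P d = P d * P c" unfolding P(3)[of c] P(3)[of d] using eH HH ee by (metis mult.assoc)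
    then have id: "(P c * P d) * (P c * P d) = P c * P d" using P(1) by (metis mult.assoc)
    have "nonzero_spectrum (aeval (G c * G d) b) = {}"
      using G(2) that by (intro nonzero_spectrum_aeval_empty)
        (metis DiffI K_def mult_eq_0_iff poly_mult singletonD)
    then have "nonzero_spectrum (e c * e d) = {}" by (simp add: e_def)
    moreover have "(H c * H d) * (e c * e d) = (e c * e d) * (H c * H d)"
      using eH by (metis mult.assoc)
    ultimately have "nonzero_spectrum (P c * P d) = {}"
      unfolding PP by (rule nonzero_spectrum_mult_quasinilpotent)
    then show ?thesis using nonzero_spectrum_idempotent[OF id, of 1] by auto
  qed
  show ?thesis
  proof (rule that[of P])
    fix c assume c: "c \<in> nonzero_spectrum b"
    show "P c * P c = P c" by (rule P)
    show "P c * b = b * P c" unfolding P(3)[of c] using bH be by (metis mult.assoc)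
    show "P c \<noteq> 0"
    proof
      \<comment> \<open>Then \<open>e c\<close> would have no nonzero spectrum, although the value 1
        of \<open>G c\<close> at c belongs to it.\<close>
      assume "P c = 0"
      then have "nonzero_spectrum (- 1 * (- e c)) = {}"
        using P(2)[of c] by (intro nonzero_spectrum_mult_quasinilpotent) auto
      moreover have "poly (G c) c \<in> spectrum (e c)"
        unfolding e_def using c by (intro spectrum_aeval_mem) (simp add: nonzero_spectrum_def)
      ultimately show False using G(1)[of c] by (auto simp: nonzero_spectrum_def)
    qed
    \<comment> \<open>Having 0 in K makes \<open>G c\<close> divisible by X, which puts
      \<open>e c\<close>, and with it \<open>P c\<close>, into A b.\<close>
    have "poly (G c) 0 = 0" using c G(2) by (auto simp: K_def nonzero_spectrum_def)
    then obtain F where "G c = pCons 0 F" by (metis pCons_cases poly_pCons mult_zero_left add.right_neutral)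
    then have "e c = aeval F b * b" unfolding e_def using aeval_commute[of b b F] by simp
    then show "\<exists>h. P c = h * b" unfolding P(3)[of c] by (metis mult.assoc)
  qed (use orth in blast)
qed

subsection \<open>Orthogonal idempotents and the spectral rank\<close>

lemma rank_bound:
  assumes "spectral_rank a = enat n"
  shows "finite (nonzero_spectrum (x * a))" "card (nonzero_spectrum (x * a)) \<le> n"
proof -
  have "ecard (nonzero_spectrum (x * a)) \<le> spectral_rank a"
    unfolding spectral_rank_def by (rule SUP_upper) simp
  then show "finite (nonzero_spectrum (x * a))" "card (nonzero_spectrum (x * a)) \<le> n"
    using assms unfolding ecard_def by (auto split: if_splits)
qed

lemma spectral_rank_eqI:
  assumes "\<And>x. finite (nonzero_spectrum (x * a)) \<and> card (nonzero_spectrum (x * a)) \<le> n"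
    and "card (nonzero_spectrum (x * a)) = n"
  shows "spectral_rank a = enat n"
  unfolding spectral_rank_def
proof (rule antisym)
  show "(SUP x. ecard (nonzero_spectrum (x * a))) \<le> enat n"
    using assms(1) by (intro SUP_least) (simp add: ecard_def)
  have "enat n = ecard (nonzero_spectrum (x * a))" using assms by (simp add: ecard_def)
  then show "enat n \<le> (SUP x. ecard (nonzero_spectrum (x * a)))" by (metis SUP_upper UNIV_I)
qed

lemma socle_iff: "a \<in> socle \<longleftrightarrow> (\<exists>n. spectral_rank a = enat n)"
  unfolding socle_def by auto

lemma rank_attaining_iff:
  assumes "spectral_rank a = enat n"
  shows "x \<in> rank_attaining a \<longleftrightarrow> card (nonzero_spectrum (x * a)) = n"
  using rank_bound(1)[OF assms, of x] assms unfolding rank_attaining_def ecard_def by simp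

lemma rank_attaining_nonempty:
  assumes "spectral_rank a = enat n"
  shows "\<exists>x. x \<in> rank_attaining a"
proof (rule ccontr)
  assume "\<nexists>x. x \<in> rank_attaining a"
  then have *: "card (nonzero_spectrum (x * a)) < n" for x
    using rank_bound(2)[OF assms, of x] rank_attaining_iff[OF assms, of x] by force
  then have "n > 0" by force
  have "spectral_rank a \<le> enat (n - 1)"
    unfolding spectral_rank_def
  proof (rule SUP_least)
    fix x
    show "ecard (nonzero_spectrum (x * a)) \<le> enat (n - 1)"
      using *[of x] rank_bound(1)[OF assms, of x] by (simp add: ecard_def)
  qed
  then show False using assms \<open>n > 0\<close> by simp
qed

lemma socle_mult:
  assumes "a \<in> socle" shows "y * a \<in> socle"
proof -
  obtain n where n: "spectral_rank a = enat n" using assms socle_iff by blast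
  have "spectral_rank (y * a) \<le> enat n"
    unfolding spectral_rank_def
  proof (rule SUP_least)
    fix x
    show "ecard (nonzero_spectrum (x * (y * a))) \<le> enat n"
      using rank_bound[OF n, of "x * y"] by (simp add: ecard_def mult.assoc)
  qed
  then show ?thesis by (cases "spectral_rank (y * a)") (auto simp: socle_iff)
qed

definition orthogonal_idempotents :: "'a::ring_1 set \<Rightarrow> bool" where
  "orthogonal_idempotents P \<longleftrightarrow> finite P \<and> (\<forall>p\<in>P. p * p = p \<and> p \<noteq> 0) \<and>
     (\<forall>p\<in>P. \<forall>p'\<in>P. p \<noteq> p' \<longrightarrow> p * p' = 0)"

definition minimal_idempotent :: "'a::complex_banach_algebra \<Rightarrow> bool" where
  "minimal_idempotent p \<longleftrightarrow> p * p = p \<and> p \<noteq> 0 \<and> (\<forall>x. \<exists>c. p * x * p = c *\<^sub>C p)"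

lemma orthogonal_idempotents_sum:
  assumes "orthogonal_idempotents P" "p \<in> P"
  shows "p * \<Sum>P = p" "\<Sum>P * p = p"
proof -
  have "p * \<Sum>P = (\<Sum>p'\<in>P. if p' = p then p else 0)"
    unfolding sum_distrib_left using assms by (intro sum.cong) (auto simp: orthogonal_idempotents_def)
  then show "p * \<Sum>P = p" using assms by (simp add: orthogonal_idempotents_def)
  have "\<Sum>P * p = (\<Sum>p'\<in>P. if p' = p then p else 0)"
    unfolding sum_distrib_right using assms by (intro sum.cong) (auto simp: orthogonal_idempotents_def)
  then show "\<Sum>P * p = p" using assms by (simp add: orthogonal_idempotents_def)
qed

lemma orthogonal_idempotents_sum_idem:
  assumes "orthogonal_idempotents P" shows "\<Sum>P * \<Sum>P = \<Sum>P"
  using orthogonal_idempotents_sum(1)[OF assms] by (subst sum_distrib_right) (auto intro: sum.cong)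

lemma nonzero_spectrum_combination:
  fixes z :: "'a::complex_banach_algebra"
  assumes "orthogonal_idempotents P" "\<And>p. p \<in> P \<Longrightarrow> p * z = 0 \<and> z * p = 0"
  shows "nonzero_spectrum ((\<Sum>p\<in>P. c p *\<^sub>C p) + z) = (c ` P - {0}) \<union> nonzero_spectrum z"
proof -
  have "finite P" using assms(1) by (simp add: orthogonal_idempotents_def)
  then show ?thesis using assms
  proof (induction P rule: finite_induct)
    case (insert p P)
    have P: "orthogonal_idempotents P" and p: "p * p = p" "p \<noteq> 0"
      and pP: "\<And>p'. p' \<in> P \<Longrightarrow> p * p' = 0 \<and> p' * p = 0"
      using insert.prems insert.hyps by (auto simp: orthogonal_idempotents_def)
    have pz: "p * z = 0" "z * p = 0" using insert.prems(2) by auto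
    have "(\<Sum>p\<in>insert p P. c p *\<^sub>C p) + z = c p *\<^sub>C p + ((\<Sum>p\<in>P. c p *\<^sub>C p) + z)"
      using insert.hyps by (simp add: add.assoc)
    also have "nonzero_spectrum \<dots> =
      nonzero_spectrum (c p *\<^sub>C p) \<union> nonzero_spectrum ((\<Sum>p\<in>P. c p *\<^sub>C p) + z)"
      using pz pP by (intro nonzero_spectrum_add_orthogonal)
        (simp_all add: distrib_left distrib_right sum_distrib_left sum_distrib_right)
    also have "\<dots> = ({c p} - {0}) \<union> ((c ` P - {0}) \<union> nonzero_spectrum z)"
      using insert.IH[OF P] insert.prems(2) nonzero_spectrum_idempotent[OF p] by simp
    finally show ?case by auto
  qed simp
qed

text \<open>The coefficients of the idempotents are free: taken distinct, nonzero and off the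
  spectrum of z, they add \<open>card P\<close> new points to the nonzero spectrum of a single
  element of A a.\<close>

lemma rank_count:
  fixes a :: "'a::complex_banach_algebra"
  assumes n: "spectral_rank a = enat n"
    and P: "orthogonal_idempotents P" "\<And>p. p \<in> P \<Longrightarrow> \<exists>y. p = y * a"
    and z: "z = y * a" "\<And>p. p \<in> P \<Longrightarrow> p * z = 0 \<and> z * p = 0"
  shows "card P + card (nonzero_spectrum z) \<le> n"
proof -
  have finP: "finite P" using P(1) by (simp add: orthogonal_idempotents_def)
  have finz: "finite (nonzero_spectrum z)" unfolding z(1) by (rule rank_bound(1)[OF n])
  have "infinite (UNIV - insert 0 (nonzero_spectrum z))"
    using finz by (simp add: Diff_infinite_finite infinite_UNIV_char_0 del: Diff_insert)
  then obtain B where B: "finite B" "card B = card P" "B \<subseteq> UNIV - insert 0 (nonzero_spectrum z)"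
    using infinite_arbitrarily_large by blast
  obtain c where c: "bij_betw c P B" using finite_same_card_bij[OF finP B(1)] B(2) by auto
  obtain Y where Y: "\<And>p. p \<in> P \<Longrightarrow> p = Y p * a" using P(2) by metis
  have eq: "(\<Sum>p\<in>P. c p *\<^sub>C p) + z = ((\<Sum>p\<in>P. c p *\<^sub>C Y p) + y) * a"
    unfolding distrib_right sum_distrib_right z(1)[symmetric] using Y
    by (metis (mono_tags, lifting) mult_scaleC_left sum.cong)
  have "nonzero_spectrum ((\<Sum>p\<in>P. c p *\<^sub>C p) + z) = B \<union> nonzero_spectrum z"
    using nonzero_spectrum_combination[OF P(1) z(2)] B(3) c by (auto simp: bij_betw_def)
  then have "card (B \<union> nonzero_spectrum z) \<le> n" using rank_bound(2)[OF n] eq by metis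
  moreover have "card (B \<union> nonzero_spectrum z) = card B + card (nonzero_spectrum z)"
    using B finz by (intro card_Un_disjoint) auto
  ultimately show ?thesis using B by simp
qed

section \<open>Invertibility in the corner p A p, expressed inside A, and minimality of
  idempotents\<close>

definition corner_invertible :: "'a::ring_1 \<Rightarrow> 'a \<Rightarrow> bool" where
  "corner_invertible p z \<longleftrightarrow> (\<exists>w. p * w = w \<and> w * p = w \<and> w * z = p \<and> z * w = p)"

lemma corner_invertible_scaleC:
  fixes z :: "'a::complex_banach_algebra"
  assumes "c \<noteq> 0" shows "corner_invertible p (c *\<^sub>C z) \<longleftrightarrow> corner_invertible p z"
proof -
  have *: "corner_invertible p (d *\<^sub>C x)" if d: "corner_invertible p x" "d \<noteq> 0" for d and x :: 'a
  proof -
    obtain w where "p * w = w" "w * p = w" "w * x = p" "x * w = p"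
      using d(1) unfolding corner_invertible_def by blast
    then show ?thesis unfolding corner_invertible_def
      by (intro exI[of _ "inverse d *\<^sub>C w"]) (simp add: d(2))
  qed
  show ?thesis using *[of z c] *[of "c *\<^sub>C z" "inverse c"] assms by auto
qed

text \<open>1 - x is the block sum of p - x in the corner and 1 - p outside it; inverses are cut and
  assembled accordingly.\<close>

lemma corner_invertible_iff:
  fixes x :: "'a::ring_1"
  assumes p: "p * p = p" and x: "p * x = x" "x * p = x"
  shows "corner_invertible p (p - x) \<longleftrightarrow> invertible_elem (1 - x)"
proof
  assume "invertible_elem (1 - x)"
  note W = inverse_elem[OF this] and inv = this
  define W where "W = inverse_elem (1 - x)"
  have pW: "p * W = W * p" unfolding W_def by (rule inverse_elem_commute[OF inv]) (simp add: x algebra_simps)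
  have "(p * W) * (p - x) = p * (W * (1 - x)) * p"
  proof -
    have "p - x = (1 - x) * p" by (simp add: left_diff_distrib x)
    then show ?thesis by (simp only: mult.assoc)
  qed
  moreover have "(p - x) * (p * W) = p * ((1 - x) * W)"
  proof -
    have "(p - x) * p = p - x" "p * (1 - x) = p - x" by (simp_all add: left_diff_distrib right_diff_distrib x p)
    then show ?thesis by (metis mult.assoc)
  qed
  moreover have "p * (p * W) = p * W" "(p * W) * p = p * W"
    using p pW by (metis mult.assoc)+
  ultimately show "corner_invertible p (p - x)"
    unfolding corner_invertible_def using W p by (intro exI[of _ "p * W"]) (simp add: W_def)
next
  assume "corner_invertible p (p - x)"
  then obtain w where w: "p * w = w" "w * p = w" "w * (p - x) = p" "(p - x) * w = p"
    unfolding corner_invertible_def by blast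
  show "invertible_elem (1 - x)"
  proof (rule invertible_elemI)
    have "(1 - x) * (w + (1 - p)) = (p - x) * w + (w - p * w) + (1 - p) - (x - x * p)"
      by (simp add: algebra_simps)
    then show "(1 - x) * (w + (1 - p)) = 1" using w x by simp
    have "(w + (1 - p)) * (1 - x) = w * (p - x) + (w - w * p) + (1 - p) - (x - p * x)"
      by (simp add: algebra_simps)
    then show "(w + (1 - p)) * (1 - x) = 1" using w x by simp
  qed
qed

lemma nonzero_spectrum_corner_iff:
  fixes z :: "'a::complex_banach_algebra"
  assumes "p * p = p" "p * z = z" "z * p = z" "c \<noteq> 0"
  shows "c \<in> nonzero_spectrum z \<longleftrightarrow> \<not> corner_invertible p (c *\<^sub>C p - z)"
proof -
  have "c *\<^sub>C p - z = c *\<^sub>C (p - inverse c *\<^sub>C z)" using assms(4) by (simp add: algebra_simps)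
  then show ?thesis
    using assms corner_invertible_iff[of p "inverse c *\<^sub>C z"]
    by (simp add: nonzero_spectrum_iff corner_invertible_scaleC)
qed

text \<open>Adding a multiple of \<open>p\<close> makes the value 0 of a corner spectrum visible to \<^const>\<open>nonzero_spectrum\<close>.\<close>

lemma minimal_idempotent_if_small_corner_spectra:
  fixes p :: "'a::complex_banach_algebra"
  assumes ss: "semisimple TYPE('a)" and p: "p * p = p" "p \<noteq> 0"
    and le1: "\<And>z. p * z = z \<Longrightarrow> z * p = z \<Longrightarrow> finite (nonzero_spectrum z) \<and> card (nonzero_spectrum z) \<le> 1"
  shows "minimal_idempotent p"
proof -
  have empty: "nonzero_spectrum z = {}" if z: "p * z = z" "z * p = z" "\<not> corner_invertible p z" for z
  proof (rule ccontr)
    assume "nonzero_spectrum z \<noteq> {}"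
    then obtain m where m: "m \<in> nonzero_spectrum z" "m \<noteq> 0" by (auto simp: nonzero_spectrum_def)
    \<comment> \<open>Both k and m + k must be nonzero; k = 1 fails only for m = -1.\<close>
    define k where "k = (if m = - 1 then 2 else (1::complex))"
    have k: "k \<noteq> 0" "m + k \<noteq> 0"
      using eq_neg_iff_add_eq_0[of m 1] by (cases "m = - 1"; simp add: k_def)+
    define y where "y = z + k *\<^sub>C p"
    have y: "p * y = y" "y * p = y" using z p by (simp_all add: y_def distrib_left distrib_right)
    have "k *\<^sub>C p - y = (- 1) *\<^sub>C z" by (simp add: y_def)
    then have "\<not> corner_invertible p (k *\<^sub>C p - y)"
      using z(3) corner_invertible_scaleC[of "- 1" p z] by simp
    then have 1: "k \<in> nonzero_spectrum y" using nonzero_spectrum_corner_iff[OF p(1) y k(1)] by simp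
    have "(m + k) *\<^sub>C p - y = m *\<^sub>C p - z" by (simp add: y_def algebra_simps)
    then have 2: "m + k \<in> nonzero_spectrum y"
      using nonzero_spectrum_corner_iff[OF p(1) y k(2)] nonzero_spectrum_corner_iff[OF p(1) z(1,2) m(2)] m(1) by simp
    have "card {k, m + k} \<le> card (nonzero_spectrum y)"
      using 1 2 le1[OF y] by (intro card_mono) auto
    then show False using le1[OF y] m(2) by simp
  qed
  have nonempty: "nonzero_spectrum z \<noteq> {}" if "corner_invertible p z" for z
    using that quasinilpotent_unit_in_corner[of p _ z] p unfolding corner_invertible_def by blast
  \<comment> \<open>For u in the corner, u y and y u are both invertible there or both without
    nonzero spectrum; the former would give y a left and a right inverse.\<close>
  have zero: "y = 0" if y: "p * y = y" "y * p = y" "\<not> corner_invertible p y" for y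
  proof (rule semisimple_eq_zero[OF ss])
    fix x
    define u where "u = p * x * p"
    have "x * y = (x * y) * p" using y by (simp add: mult.assoc)
    then have "nonzero_spectrum (x * y) = nonzero_spectrum (p * (x * y))" using nonzero_spectrum_swap by metis
    also have "p * (x * y) = u * y" using y by (simp add: u_def mult.assoc)
    finally have eq: "nonzero_spectrum (x * y) = nonzero_spectrum (u * y)" .
    have uy: "p * (u * y) = u * y" "(u * y) * p = u * y" "p * (y * u) = y * u" "(y * u) * p = y * u"
      using y p by (simp_all add: u_def mult.assoc) (simp_all flip: mult.assoc add: p y)
    show "nonzero_spectrum (x * y) = {}"
    proof (rule ccontr)
      assume "nonzero_spectrum (x * y) \<noteq> {}"
      then have "nonzero_spectrum (u * y) \<noteq> {}" "nonzero_spectrum (y * u) \<noteq> {}"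
        using eq nonzero_spectrum_swap[of u y] by auto
      then have "corner_invertible p (u * y)" "corner_invertible p (y * u)" using empty uy by blast+
      then obtain w w' where w: "w * (u * y) = p" "p * w = w" and w': "(y * u) * w' = p" "w' * p = w'"
        unfolding corner_invertible_def by blast
      have 1: "(w * u) * y = p" "y * (u * w') = p" using w w' by (simp_all add: mult.assoc)
      have pu: "p * u = u" "u * p = u" using p by (simp_all add: u_def flip: mult.assoc) (simp add: mult.assoc)
      have "w * u = (w * u) * (y * (u * w'))" using 1(2) pu by (simp add: mult.assoc)
      also have "\<dots> = p * (u * w')" using 1(1) by (simp flip: mult.assoc)
      also have "\<dots> = u * w'" using pu by (simp flip: mult.assoc)
      finally have e: "w * u = u * w'" .
      have "p * (w * u) = w * u" "(w * u) * p = w * u"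
        using w pu by (simp_all add: mult.assoc) (simp flip: mult.assoc)
      then have "corner_invertible p y"
        unfolding corner_invertible_def using 1 e by metis
      then show False using y(3) by blast
    qed
  qed
  have "\<exists>c. p * x * p = c *\<^sub>C p" for x
  proof -
    define z where "z = p * x * p"
    have z: "p * z = z" "z * p = z" using p by (simp_all add: z_def mult.assoc) (simp flip: mult.assoc add: p)
    \<comment> \<open>This plays the part of Gelfand-Mazur: c is 0, or a point of the nonzero
      spectrum, which is nonempty when z is invertible in the corner.\<close>
    have "\<exists>c. \<not> corner_invertible p (c *\<^sub>C p - z)"
    proof (cases "corner_invertible p z")
      case False
      then show ?thesis using corner_invertible_scaleC[of "- 1" p z] by (intro exI[of _ 0]) simp
    next
      case True
      then obtain c where "c \<in> nonzero_spectrum z" "c \<noteq> 0"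
        using nonempty by (force simp: nonzero_spectrum_def)
      then show ?thesis using nonzero_spectrum_corner_iff[OF p(1) z] by blast
    qed
    then obtain c where "\<not> corner_invertible p (c *\<^sub>C p - z)" by blast
    then have "c *\<^sub>C p - z = 0"
      using z p by (intro zero) (simp_all add: right_diff_distrib left_diff_distrib)
    then show ?thesis by (metis z_def right_minus_eq)
  qed
  then show ?thesis using p by (auto simp: minimal_idempotent_def)
qed

section \<open>Maximal orthogonal families of idempotents in A a, and diagonalization\<close>

context
  fixes a :: "'a::complex_banach_algebra" and n P
  assumes ss: "semisimple TYPE('a)" and n: "spectral_rank a = enat n"
    and P: "orthogonal_idempotents P" "card P = n" "\<And>p. p \<in> P \<Longrightarrow> \<exists>y. p = y * a"
begin

text \<open>The other n - 1 idempotents are orthogonal to p A p, so \<open>rank_count\<close> leaves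
  at most one nonzero spectral value to each corner element.\<close>

lemma minimal_of_maximal_orthogonal:
  assumes "p \<in> P" shows "minimal_idempotent p"
proof (rule minimal_idempotent_if_small_corner_spectra[OF ss])
  show "p * p = p" "p \<noteq> 0" using P(1) assms by (auto simp: orthogonal_idempotents_def)
  fix z assume z: "p * z = z" "z * p = z"
  obtain y where "p = y * a" using P(3) assms by blast
  then have za: "z = (z * y) * a" using z by (simp add: mult.assoc)
  have "card (P - {p}) + card (nonzero_spectrum z) \<le> n"
  proof (rule rank_count[OF n _ _ za])
    show "orthogonal_idempotents (P - {p})" using P(1) by (auto simp: orthogonal_idempotents_def)
    fix p' assume "p' \<in> P - {p}"
    then have "p' * p = 0" "p * p' = 0" using P(1) assms by (auto simp: orthogonal_idempotents_def)
    then show "p' * z = 0 \<and> z * p' = 0" using z by (metis mult.assoc mult_zero_left mult_zero_right)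
  qed (use P in auto)
  moreover have "card (P - {p}) = n - 1" "n > 0"
    using P assms by (auto simp: orthogonal_idempotents_def card_gt_0_iff)
  moreover have "finite (nonzero_spectrum z)" using rank_bound(1)[OF n] za by metis
  ultimately show "finite (nonzero_spectrum z) \<and> card (nonzero_spectrum z) \<le> 1" by auto
qed

text \<open>Swapping turns z a (1 - q) into an element of A a orthogonal to all of P; the n
  idempotents already exhaust the rank, so no nonzero spectrum is left and semisimplicity
  applies.\<close>

lemma mult_sum_maximal_orthogonal: "a * \<Sum>P = a"
proof -
  define q where "q = \<Sum>P"
  have qq: "q * q = q" unfolding q_def by (rule orthogonal_idempotents_sum_idem[OF P(1)])
  obtain Y where Y: "\<And>p. p \<in> P \<Longrightarrow> p = Y p * a" using P(3) by metis
  have q: "q = (\<Sum>p\<in>P. Y p) * a" unfolding q_def sum_distrib_right using Y by (intro sum.cong) auto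
  have idem: "(1 - q) * (1 - q) = 1 - q" using qq by (simp add: algebra_simps)
  have "a * (1 - q) = 0"
  proof (rule semisimple_eq_zero[OF ss])
    fix z
    define d where "d = (1 - q) * (z * a * (1 - q))"
    have "z * (a * (1 - q)) = (z * a * (1 - q)) * (1 - q)" using idem by (simp add: mult.assoc)
    then have eq: "nonzero_spectrum (z * (a * (1 - q))) = nonzero_spectrum d"
      unfolding d_def using nonzero_spectrum_swap by metis
    have "d = (1 - q) * z * a - (1 - q) * z * a * q" by (simp add: d_def algebra_simps)
    also have "\<dots> = ((1 - q) * z - (1 - q) * z * a * (\<Sum>p\<in>P. Y p)) * a"
      unfolding left_diff_distrib q[symmetric] by (simp add: mult.assoc flip: q)
    finally have da: "d = ((1 - q) * z - (1 - q) * z * a * (\<Sum>p\<in>P. Y p)) * a" .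
    have "card P + card (nonzero_spectrum d) \<le> n"
    proof (rule rank_count[OF n P(1,3) da])
      fix p assume "p \<in> P"
      then have "p * (1 - q) = 0" "(1 - q) * p = 0"
        using orthogonal_idempotents_sum[OF P(1)] by (simp_all add: q_def algebra_simps)
      then show "p * d = 0 \<and> d * p = 0"
        unfolding d_def by (metis mult.assoc mult_zero_left mult_zero_right)
    qed
    then have "card (nonzero_spectrum d) = 0" using P(2) by simp
    moreover have "finite (nonzero_spectrum d)" using rank_bound(1)[OF n] da by metis
    ultimately show "nonzero_spectrum (z * (a * (1 - q))) = {}" using eq by simp
  qed
  then show ?thesis by (simp add: q_def algebra_simps)
qed

end

lemma diagonalization:
  fixes a :: "'a::complex_banach_algebra"
  assumes ss: "semisimple TYPE('a)" and n: "spectral_rank a = enat n" and x: "x \<in> rank_attaining a"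
  obtains P c where "orthogonal_idempotents P" "card P = n" "\<And>p. p \<in> P \<Longrightarrow> minimal_idempotent p"
    "\<And>p. p \<in> P \<Longrightarrow> \<exists>y. p = y * a" "a * \<Sum>P = a"
    "x * a = (\<Sum>p\<in>P. c p *\<^sub>C p)" "inj_on c P" "c ` P = nonzero_spectrum (x * a)"
proof -
  define b where "b = x * a"
  have fin: "finite (nonzero_spectrum b)" and card: "card (nonzero_spectrum b) = n"
    using rank_bound(1)[OF n] x rank_attaining_iff[OF n] by (auto simp: b_def)
  then have "finite (spectrum b)" by (simp add: nonzero_spectrum_def)
  then obtain R where R: "\<And>c. c \<in> nonzero_spectrum b \<Longrightarrow> R c * R c = R c"
    "\<And>c. c \<in> nonzero_spectrum b \<Longrightarrow> R c \<noteq> 0"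
    "\<And>c. c \<in> nonzero_spectrum b \<Longrightarrow> \<exists>h. R c = h * b"
    "\<And>c. c \<in> nonzero_spectrum b \<Longrightarrow> R c * b = b * R c"
    "\<And>c d. c \<in> nonzero_spectrum b \<Longrightarrow> d \<in> nonzero_spectrum b \<Longrightarrow> c \<noteq> d \<Longrightarrow> R c * R d = 0"
    by (rule spectral_idempotents) blast
  define P where "P = R ` nonzero_spectrum b"
  have orth: "orthogonal_idempotents P"
    unfolding orthogonal_idempotents_def P_def using R(1,2,5) fin by (auto; metis)
  have "inj_on R (nonzero_spectrum b)" using R by (metis inj_onI)
  then have cardP: "card P = n" using card by (simp add: P_def card_image)
  have Pa: "\<exists>y. p = y * a" if "p \<in> P" for p
    using that R(3) unfolding P_def b_def by (metis imageE mult.assoc)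
  have min: "minimal_idempotent p" if "p \<in> P" for p
    by (rule minimal_of_maximal_orthogonal[OF ss n orth cardP _ that]) (rule Pa)
  have aP: "a * \<Sum>P = a"
    by (rule mult_sum_maximal_orthogonal[OF ss n orth cardP]) (rule Pa)
  have "\<exists>c. p * b = c *\<^sub>C p" if "p \<in> P" for p
  proof -
    have "p * b = b * p" "p * p = p" using that R unfolding P_def by blast+
    then have "p * b = p * b * p" by (metis mult.assoc)
    then show ?thesis using min[OF that] unfolding minimal_idempotent_def by metis
  qed
  then obtain c where c: "\<And>p. p \<in> P \<Longrightarrow> p * b = c p *\<^sub>C p" by metis
  have "b = b * \<Sum>P" using aP by (simp add: b_def mult.assoc)
  also have "\<dots> = (\<Sum>p\<in>P. b * p)" by (rule sum_distrib_left)
  also have "\<dots> = (\<Sum>p\<in>P. c p *\<^sub>C p)"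
    using c R(4) unfolding P_def by (intro sum.cong) auto
  finally have b: "b = (\<Sum>p\<in>P. c p *\<^sub>C p)" .
  have sp: "nonzero_spectrum b = c ` P - {0}"
    using nonzero_spectrum_combination[OF orth, of 0 c] b by simp
  have finP: "finite P" using orth by (simp add: orthogonal_idempotents_def)
  \<comment> \<open>\<open>card P\<close> distinct nonzero values among at most
    \<open>card P\<close> coefficients force c to be injective and never 0.\<close>
  have "card (c ` P - {0}) = card P" using sp card cardP by simp
  moreover have "card (c ` P - {0}) \<le> card (c ` P)" "card (c ` P) \<le> card P"
    using finP by (auto intro: card_mono card_image_le)
  ultimately have "card (c ` P) = card P" "card (c ` P - {0}) = card (c ` P)" by linarith+
  then have inj: "inj_on c P" and card_eq: "card (c ` P - {0}) = card (c ` P)"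
    using finP by (simp_all add: eq_card_imp_inj_on del: card_Diff_insert)
  have im: "c ` P - {0} = c ` P" by (rule card_subset_eq[OF _ _ card_eq]) (use finP in auto)
  show ?thesis
  proof (rule that[of P c])
    show "x * a = (\<Sum>p\<in>P. c p *\<^sub>C p)" using b by (simp only: b_def)
    show "c ` P = nonzero_spectrum (x * a)" using sp im by (simp only: b_def)
  qed (fact orth cardP aP inj | erule min Pa)+
qed

section \<open>Rank one projections and minimal idempotents\<close>

lemma minimal_idempotent_rank:
  fixes p :: "'a::complex_banach_algebra"
  assumes "minimal_idempotent p" shows "spectral_rank p = 1"
proof -
  have p: "p * p = p" "p \<noteq> 0" using assms by (auto simp: minimal_idempotent_def)
  have "\<exists>c. nonzero_spectrum (x * p) = {c} - {0}" for x
  proof -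
    obtain c where c: "p * x * p = c *\<^sub>C p" using assms by (auto simp: minimal_idempotent_def)
    have "nonzero_spectrum ((x * p) * p) = nonzero_spectrum (p * (x * p))" by (rule nonzero_spectrum_swap)
    then have "nonzero_spectrum (x * p) = nonzero_spectrum (c *\<^sub>C p)" using p c by (simp add: mult.assoc)
    then show ?thesis using nonzero_spectrum_idempotent[OF p] by blast
  qed
  then have "finite (nonzero_spectrum (x * p)) \<and> card (nonzero_spectrum (x * p)) \<le> 1" for x
    by (metis Diff_subset card_mono card.empty card_insert_disjoint empty_iff finite.emptyI finite_insert finite_subset One_nat_def)
  moreover have "card (nonzero_spectrum (1 * p)) = 1" using nonzero_spectrum_idempotent[OF p, of 1] by simp
  ultimately have "spectral_rank p = enat 1" by (rule spectral_rank_eqI)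
  then show ?thesis by (simp add: one_enat_def)
qed

text \<open>A rank one projection p forms by itself a maximal orthogonal family in A p, so the
  counting results apply with a = p.\<close>

lemma rank_one_projections_eq:
  assumes ss: "semisimple TYPE('a::complex_banach_algebra)"
  shows "rank_one_projections = {p::'a. minimal_idempotent p}"
proof (intro set_eqI iffI)
  fix p :: 'a assume "p \<in> {p. minimal_idempotent p}"
  then show "p \<in> rank_one_projections"
    using minimal_idempotent_rank by (auto simp: rank_one_projections_def minimal_idempotent_def)
next
  fix p :: 'a assume "p \<in> rank_one_projections"
  then have p: "p * p = p" "spectral_rank p = enat 1" by (auto simp: rank_one_projections_def one_enat_def)
  have "p \<noteq> 0"
  proof
    assume "p = 0"
    then have "spectral_rank p = enat 0" by (intro spectral_rank_eqI) auto
    then show False using p by simp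
  qed
  then have "minimal_idempotent p"
    using p by (intro minimal_of_maximal_orthogonal[OF ss p(2), of "{p}"])
      (auto simp: orthogonal_idempotents_def intro!: exI[of _ 1])
  then show "p \<in> {p. minimal_idempotent p}" by simp
qed

text \<open>Semisimplicity provides z such that z u has nonzero spectrum; p z u is then a nonzero
  multiple of p.\<close>

lemma minimal_idempotent_left_inverse:
  fixes p u :: "'a::complex_banach_algebra"
  assumes ss: "semisimple TYPE('a)" and p: "minimal_idempotent p" and u: "u * p = u" "u \<noteq> 0"
  obtains v where "p * v = v" "v * u = p"
proof -
  obtain z where "nonzero_spectrum (z * u) \<noteq> {}" using semisimple_eq_zero[OF ss] u by blast
  moreover have "nonzero_spectrum (z * u * p) = nonzero_spectrum (p * (z * u))" by (rule nonzero_spectrum_swap)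
  ultimately have ne: "nonzero_spectrum (p * (z * u)) \<noteq> {}" using u by (simp add: mult.assoc)
  obtain c where c: "p * (z * u) * p = c *\<^sub>C p" using p by (auto simp: minimal_idempotent_def)
  then have c: "p * (z * u) = c *\<^sub>C p" using u by (simp add: mult.assoc)
  then have "c \<noteq> 0" using ne by auto
  show ?thesis
  proof (rule that[of "inverse c *\<^sub>C (p * z)"])
    show "p * (inverse c *\<^sub>C (p * z)) = inverse c *\<^sub>C (p * z)"
      using p by (simp add: minimal_idempotent_def flip: mult.assoc)
    show "inverse c *\<^sub>C (p * z) * u = p" using c \<open>c \<noteq> 0\<close> by (simp add: mult.assoc)
  qed
qed

text \<open>y v and p = v y are equivalent idempotents, and minimality passes along the map sending
  x to v x y. This serves both to perturb a minimal idempotent and to turn eigenvectors into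
  idempotents.\<close>

lemma minimal_idempotent_transfer:
  fixes p y v :: "'a::complex_banach_algebra"
  assumes p: "minimal_idempotent p" and "y * p = y" "p * v = v" "v * y = p"
  shows "minimal_idempotent (y * v)"
proof -
  have "(y * v) * (y * v) = y * (v * y) * v" by (simp add: mult.assoc)
  then have "(y * v) * (y * v) = y * v" using assms by simp
  moreover have "y * v \<noteq> 0"
  proof
    assume "y * v = 0"
    then have "v * (y * v) * y = 0" by simp
    moreover have "v * (y * v) * y = (v * y) * (v * y)" by (simp add: mult.assoc)
    ultimately show False using assms(4) p by (auto simp: minimal_idempotent_def)
  qed
  moreover have "\<exists>c. (y * v) * x * (y * v) = c *\<^sub>C (y * v)" for x
  proof -
    obtain c where c: "p * (v * x * y) * p = c *\<^sub>C p" using p by (auto simp: minimal_idempotent_def)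
    have "(y * v) * x * (y * v) = (y * p) * (p * v) * x * (y * p) * (p * v)" using assms by (simp add: mult.assoc)
    also have "\<dots> = y * (p * (p * v * x * y) * p) * (p * v)" by (simp add: mult.assoc)
    finally show ?thesis using assms c by auto
  qed
  ultimately show ?thesis by (auto simp: minimal_idempotent_def)
qed

subsection \<open>Eigenvectors in corners of the socle\<close>

text \<open>A nonzero u in p' A p has a left inverse v with v u = p, so p' x p = (p' x v p') u, a
  multiple of u by minimality of p'.\<close>

lemma minimal_corner_line:
  fixes p p' :: "'a::complex_banach_algebra"
  assumes ss: "semisimple TYPE('a)" and p: "minimal_idempotent p" and p': "minimal_idempotent p'"
  shows "\<exists>u. \<forall>x. \<exists>c. p' * x * p = c *\<^sub>C u"
proof (cases "\<forall>x. p' * x * p = 0")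
  case True
  then show ?thesis by (intro exI[of _ 0]) simp
next
  case False
  then obtain x0 where x0: "p' * x0 * p \<noteq> 0" by blast
  define u where "u = p' * x0 * p"
  have u: "u * p = u" "p' * u = u" "u \<noteq> 0"
    using p p' x0 by (simp_all add: u_def minimal_idempotent_def mult.assoc)
      (simp add: minimal_idempotent_def flip: mult.assoc)
  obtain v where v: "v * u = p" using minimal_idempotent_left_inverse[OF ss p u(1,3)] by blast
  have "\<exists>c. p' * x * p = c *\<^sub>C u" for x
  proof -
    obtain c where c: "p' * (x * v) * p' = c *\<^sub>C p'" using p' by (auto simp: minimal_idempotent_def)
    have "p' * x * p = p' * (x * v) * (p' * u)" using v u(2) by (simp add: mult.assoc)
    also have "\<dots> = (p' * (x * v) * p') * u" by (simp add: mult.assoc)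
    finally show ?thesis using c u(2) by auto
  qed
  then show ?thesis by blast
qed

text \<open>Phrased for sequences because the vectors \<open>g ^ k * (q * p)\<close> it is applied
  to may repeat; a repetition is a dependence with coefficients 1 and -1.\<close>

lemma dependent_sequence:
  fixes s :: "nat \<Rightarrow> 'a::complex_banach_algebra"
  assumes "finite B" "\<And>k. s k \<in> scaleC.span B"
  shows "\<exists>c. (\<exists>k\<le>card B. c k \<noteq> 0) \<and> (\<Sum>k\<le>card B. c k *\<^sub>C s k) = 0"
proof (cases "inj_on s {..card B}")
  case True
  have "scaleC.dependent (s ` {..card B})"
  proof (rule ccontr)
    assume "\<not> ?thesis"
    then have "card (s ` {..card B}) \<le> card B"
      using scaleC.independent_span_bound[OF assms(1), of "s ` {..card B}"] assms(2) by blast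
    then show False using card_image[OF True] by simp
  qed
  then obtain u where "\<exists>v\<in>s ` {..card B}. u v \<noteq> 0" "(\<Sum>v\<in>s ` {..card B}. u v *\<^sub>C v) = 0"
    by (subst (asm) scaleC.dependent_finite) auto
  then show ?thesis using True by (intro exI[of _ "\<lambda>k. u (s k)"]) (auto simp: sum.reindex)
next
  case False
  then obtain i j where ij: "i \<le> card B" "j \<le> card B" "s i = s j" "i \<noteq> j" by (auto simp: inj_on_def)
  define c :: "nat \<Rightarrow> complex" where "c k = (if k = i then 1 else 0) - (if k = j then 1 else 0)" for k
  have "(\<Sum>k\<le>card B. c k *\<^sub>C s k) = (\<Sum>k\<le>card B. (if k = i then s k else 0)) - (\<Sum>k\<le>card B. (if k = j then s k else 0))"
    unfolding sum_subtractf[symmetric] by (intro sum.cong) (auto simp: c_def)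
  also have "\<dots> = 0" using ij by simp
  finally show ?thesis using ij by (intro exI[of _ c]) (auto simp: c_def intro!: exI[of _ i])
qed

lemma aeval_monom: "aeval (monom c k) x = c *\<^sub>C x ^ k"
  by (induction k) (simp_all add: monom_0 monom_Suc)

text \<open>Strip linear factors from G while the quotient still annihilates y; the first quotient
  that does not gives an eigenvector for the root just removed.\<close>

lemma eigenvector_of_annihilating_polynomial:
  fixes g y :: "'a::complex_banach_algebra"
  assumes "G \<noteq> 0" "aeval G g * y = 0" "y \<noteq> 0"
  shows "\<exists>l H. aeval H g * y \<noteq> 0 \<and> g * (aeval H g * y) = l *\<^sub>C (aeval H g * y)"
  using assms(1,2)
proof (induction "degree G" arbitrary: G)
  case 0
  then obtain c where "G = [:c:]" by (metis degree_eq_zeroE)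
  then show ?case using 0 \<open>y \<noteq> 0\<close> by simp
next
  case (Suc n)
  then have "\<not> constant (poly G)" by (simp add: constant_degree)
  then obtain l where l: "poly G l = 0" using fundamental_theorem_of_algebra by blast
  then obtain H where H: "G = [:- l, 1:] * H" using poly_eq_0_iff_dvd by (metis dvdE)
  have "H \<noteq> 0" using H Suc.prems(1) by auto
  have "degree G = Suc (degree H)" unfolding H using \<open>H \<noteq> 0\<close> by (subst degree_mult_eq) auto
  have "aeval G g = g * aeval H g - l *\<^sub>C aeval H g" unfolding H aeval_mult by (simp add: algebra_simps)
  then have *: "g * (aeval H g * y) = l *\<^sub>C (aeval H g * y)"
    using Suc.prems(2) by (simp add: left_diff_distrib mult.assoc)
  show ?case
  proof (cases "aeval H g * y = 0")
    case True
    then show ?thesis using Suc \<open>H \<noteq> 0\<close> \<open>degree G = Suc (degree H)\<close> by auto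
  next
    case False
    then show ?thesis using * by blast
  qed
qed

text \<open>Left multiplication by g acts on q A p, which is finite-dimensional because each p' A p
  is at most a line. An eigenvector y there becomes an idempotent y v through a left inverse
  v.\<close>

lemma eigen_idempotent:
  fixes a :: "'a::complex_banach_algebra"
  assumes ss: "semisimple TYPE('a)" and a: "a \<in> socle"
    and q: "q * q = q" "q \<noteq> 0" "q = w * a" and g: "q * g = g" "g * q = g"
  obtains e l where "minimal_idempotent e" "q * e = e" "e * q = e" "g * e = l *\<^sub>C e"
proof -
  obtain n where n: "spectral_rank a = enat n" using a socle_iff by blast
  obtain x where x: "x \<in> rank_attaining a" using rank_attaining_nonempty[OF n] by blast
  obtain P where P: "orthogonal_idempotents P" "\<And>p. p \<in> P \<Longrightarrow> minimal_idempotent p" "a * \<Sum>P = a"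
    by (rule diagonalization[OF ss n x]) blast
  have finP: "finite P" using P(1) by (simp add: orthogonal_idempotents_def)
  \<comment> \<open>Being in A a, q is fixed by the sum of P; hence some q p is nonzero and can
    start an orbit under g.\<close>
  have qP: "q * \<Sum>P = q" using q(3) P(3) by (simp add: mult.assoc)
  then have "(\<Sum>p\<in>P. q * p) \<noteq> 0" using q(2) by (simp add: sum_distrib_left)
  then obtain p where p: "p \<in> P" "q * p \<noteq> 0" by (metis sum.neutral)
  have pp: "p * p = p" using P(2)[OF p(1)] by (simp add: minimal_idempotent_def)
  have "\<forall>p'\<in>P. \<exists>u. \<forall>x. \<exists>c. p' * x * p = c *\<^sub>C u"
    using minimal_corner_line[OF ss P(2)[OF p(1)] P(2)] by blast
  then obtain u where u: "\<And>p' x. p' \<in> P \<Longrightarrow> \<exists>c. p' * x * p = c *\<^sub>C u p'" by metis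
  define B where "B = (\<lambda>p'. q * u p') ` P"
  have span: "y \<in> scaleC.span B" if y: "q * y = y" "y * p = y" for y
  proof -
    have "y = q * (\<Sum>P * y)" using qP y by (simp flip: mult.assoc)
    also have "\<dots> = (\<Sum>p'\<in>P. q * (p' * y * p))" using y by (simp add: sum_distrib_left sum_distrib_right mult.assoc)
    also have "\<dots> \<in> scaleC.span B"
    proof (rule scaleC.span_sum)
      fix p' assume p': "p' \<in> P"
      then obtain c where "p' * y * p = c *\<^sub>C u p'" using u by blast
      then have "q * (p' * y * p) = c *\<^sub>C (q * u p')" by simp
      moreover have "q * u p' \<in> B" using p' by (simp add: B_def)
      ultimately show "q * (p' * y * p) \<in> scaleC.span B"
        by (metis scaleC.span_base scaleC.span_scale)
    qed
    finally show ?thesis .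
  qed
  define s where "s k = g ^ k * (q * p)" for k
  have "s k \<in> scaleC.span B" for k
  proof (rule span)
    show "s k * p = s k" by (simp add: s_def mult.assoc pp)
    show "q * s k = s k"
      by (cases k) (simp_all add: s_def q(1) g(1) flip: mult.assoc)
  qed
  then obtain c where c: "\<exists>k\<le>card B. c k \<noteq> 0" "(\<Sum>k\<le>card B. c k *\<^sub>C s k) = 0"
    using dependent_sequence[of B s] finP by (auto simp: B_def)
  define G where "G = (\<Sum>k\<le>card B. monom (c k) k)"
  have "coeff G k = c k" if "k \<le> card B" for k using that by (simp add: G_def coeff_sum)
  then have "G \<noteq> 0" using c(1) by (metis coeff_0)
  moreover have "aeval G g * (q * p) = 0"
    using c(2) by (simp add: G_def aeval_sum aeval_monom s_def sum_distrib_right)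
  ultimately obtain l H where H: "aeval H g * (q * p) \<noteq> 0"
    "g * (aeval H g * (q * p)) = l *\<^sub>C (aeval H g * (q * p))"
    using eigenvector_of_annihilating_polynomial p(2) by blast
  define y where "y = aeval H g * (q * p)"
  have y0: "y \<noteq> 0" "g * y = l *\<^sub>C y" using H by (auto simp: y_def)
  have "q * aeval H g = aeval H g * q" by (rule aeval_commute) (simp add: g)
  then have "q * y = aeval H g * (q * (q * p))" by (simp add: y_def flip: mult.assoc)
  then have qy: "q * y = y" using q(1) by (simp add: y_def flip: mult.assoc)
  have yp: "y * p = y" by (simp add: y_def mult.assoc pp)
  obtain v0 where v0: "p * v0 = v0" "v0 * y = p"
    using minimal_idempotent_left_inverse[OF ss P(2)[OF p(1)] yp y0(1)] by blast
  \<comment> \<open>Cutting by q on the right puts y v into q A q without disturbing v y =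
    p.\<close>
  define v where "v = v0 * q"
  have v: "p * v = v" "v * y = p" "v * q = v"
    using v0 qy q(1) by (simp_all add: v_def mult.assoc) (simp flip: mult.assoc)
  show ?thesis
  proof (rule that[of "y * v" l])
    show "minimal_idempotent (y * v)"
      by (rule minimal_idempotent_transfer[OF P(2)[OF p(1)] yp v(1,2)])
    show "q * (y * v) = y * v" using qy by (simp flip: mult.assoc)
    show "y * v * q = y * v" using v(3) by (simp add: mult.assoc)
    show "g * (y * v) = l *\<^sub>C (y * v)" using y0(2) by (simp flip: mult.assoc)
  qed
qed

subsection \<open>Functionals normalized on minimal idempotents\<close>

text \<open>The value \<alpha> may be 0, so that the given functional f is an instance before it can
  be divided by \<alpha>.\<close>

locale constant_on_minimal =
  fixes a :: "'a::complex_banach_algebra" and T :: "'a \<Rightarrow> complex" and \<alpha> :: complex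
  assumes ss: "semisimple TYPE('a)" and socle: "a \<in> socle"
    and T_add: "T (x * a + y * a) = T (x * a) + T (y * a)"
    and T_scaleC: "T (c *\<^sub>C (x * a)) = c * T (x * a)"
    and T_minimal: "minimal_idempotent (y * a) \<Longrightarrow> T (y * a) = \<alpha>"
begin

definition "n = the_enat (spectral_rank a)"

lemma n: "spectral_rank a = enat n"
  using socle unfolding socle_iff n_def by auto

lemma T_zero: "T 0 = 0"
  using T_scaleC[of 0 0] by simp

lemma T_diff: "T (x * a - y * a) = T (x * a) - T (y * a)"
  using T_add[of x "(- 1) *\<^sub>C y"] T_scaleC[of "- 1" y] by simp

lemma T_sum: "T (\<Sum>i\<in>I. y i * a) = (\<Sum>i\<in>I. T (y i * a))"
proof (induction I rule: infinite_finite_induct)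
  case (insert i I)
  then show ?case using T_add[of "y i" "\<Sum>i\<in>I. y i"] by (simp add: sum_distrib_right)
qed (simp_all add: T_zero)

text \<open>\<open>u p - c p = (1 - p) u p\<close> is a difference of two minimal idempotents.\<close>

lemma T_mult_minimal:
  assumes p: "minimal_idempotent p" "p = y * a" and c: "p * u * p = c *\<^sub>C p"
  shows "T (u * p) = c * \<alpha>"
proof -
  have pp: "p * p = p" using p by (simp add: minimal_idempotent_def)
  define w where "w = u * p - c *\<^sub>C p"
  have w: "p * w = 0" "w * p = w"
    using c pp by (simp_all add: w_def algebra_simps)
  have "minimal_idempotent ((p + w) * p)"
    by (rule minimal_idempotent_transfer[OF p(1)]) (simp_all add: w pp algebra_simps)
  moreover have "(p + w) * p = p + w" using w pp by (simp add: algebra_simps)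
  moreover have "p + w = ((1 + u - c *\<^sub>C 1) * y) * a"
    using p(2) by (simp add: w_def algebra_simps)
  ultimately have "T (p + w) = \<alpha>" using T_minimal by metis
  moreover have "T p = \<alpha>" using T_minimal p by metis
  moreover have wa: "w = ((u - c *\<^sub>C 1) * y) * a" using p(2) by (simp add: w_def algebra_simps)
  then have "T (p + w) = T p + T w" using T_add[of y "(u - c *\<^sub>C 1) * y"] p(2) by simp
  ultimately have "T w = 0" by simp
  have "u * p = (c *\<^sub>C y) * a + ((u - c *\<^sub>C 1) * y) * a" using p(2) by (simp add: algebra_simps)
  then have "T (u * p) = T ((c *\<^sub>C y) * a) + T w" using T_add wa by metis
  then show ?thesis using \<open>T w = 0\<close> \<open>T p = \<alpha>\<close> T_scaleC[of c y] p(2) by simp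
qed

text \<open>The sum of P breaks y a into pieces y a p, whose values are \<alpha> times the scalars
  of p y a p. Vanishing for \<alpha> = 0 and boundedness both follow from this.\<close>

lemma T_decomposition:
  obtains P where "\<And>p. p \<in> P \<Longrightarrow> minimal_idempotent p"
    "\<And>y. T (y * a) = (\<Sum>p\<in>P. T (y * a * p))"
    "\<And>p u c. p \<in> P \<Longrightarrow> p * u * p = c *\<^sub>C p \<Longrightarrow> T (u * p) = c * \<alpha>"
proof -
  obtain x where x: "x \<in> rank_attaining a" using rank_attaining_nonempty[OF n] by blast
  obtain P where P: "\<And>p. p \<in> P \<Longrightarrow> minimal_idempotent p"
    "\<And>p. p \<in> P \<Longrightarrow> \<exists>y. p = y * a" "a * \<Sum>P = a"
    by (rule diagonalization[OF ss n x]) blast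
  obtain Y where Y: "\<And>p. p \<in> P \<Longrightarrow> p = Y p * a" using P(2) by metis
  have "T (y * a) = (\<Sum>p\<in>P. T (y * a * p))" for y
  proof -
    have "y * a = y * (a * \<Sum>P)" by (simp add: P(3))
    also have "\<dots> = (\<Sum>p\<in>P. y * a * p)" by (simp add: sum_distrib_left mult.assoc)
    also have "\<dots> = (\<Sum>p\<in>P. (y * a * Y p) * a)" using Y by (intro sum.cong) (auto simp: mult.assoc)
    finally have "T (y * a) = (\<Sum>p\<in>P. T ((y * a * Y p) * a))" using T_sum by metis
    also have "\<dots> = (\<Sum>p\<in>P. T (y * a * p))" using Y by (intro sum.cong) (auto simp: mult.assoc)
    finally show ?thesis .
  qed
  then show ?thesis using that P(1) T_mult_minimal Y by blast
qed

text \<open>Covers the case in which the functional cannot be rescaled to value 1 on minimal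
  idempotents.\<close>

lemma T_eq_zero:
  assumes "\<alpha> = 0" shows "T a = 0"
proof -
  obtain P where P: "\<And>p. p \<in> P \<Longrightarrow> minimal_idempotent p"
    "\<And>y. T (y * a) = (\<Sum>p\<in>P. T (y * a * p))"
    "\<And>p u c. p \<in> P \<Longrightarrow> p * u * p = c *\<^sub>C p \<Longrightarrow> T (u * p) = c * \<alpha>"
    by (rule T_decomposition) blast
  have "T (1 * a * p) = 0" if p: "p \<in> P" for p
  proof -
    obtain c where "p * (1 * a) * p = c *\<^sub>C p" using P(1)[OF p] unfolding minimal_idempotent_def by metis
    then have "T (1 * a * p) = c * \<alpha>" by (rule P(3)[OF p])
    then show ?thesis using assms by simp
  qed
  then show ?thesis using P(2)[of 1] by simp
qed

text \<open>Automatic continuity: the scalar in p y a p = c p satisfies cmod c * norm p = norm (p y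
  a p), and norm p > 0.\<close>

lemma T_bound: "\<exists>C\<ge>0. \<forall>y. cmod (T (y * a)) \<le> C * norm y"
proof -
  obtain P where P: "\<And>p. p \<in> P \<Longrightarrow> minimal_idempotent p"
    "\<And>y. T (y * a) = (\<Sum>p\<in>P. T (y * a * p))"
    "\<And>p u c. p \<in> P \<Longrightarrow> p * u * p = c *\<^sub>C p \<Longrightarrow> T (u * p) = c * \<alpha>"
    by (rule T_decomposition) blast
  have bound: "cmod (T (y * a * p)) \<le> cmod \<alpha> * norm a * norm p * norm y" if p: "p \<in> P" for y p
  proof -
    have p0: "norm p > 0" using P(1)[OF p] by (simp add: minimal_idempotent_def)
    obtain c where c: "p * (y * a) * p = c *\<^sub>C p" using P(1)[OF p] by (auto simp: minimal_idempotent_def)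
    have "cmod c * norm p = norm (p * (y * a) * p)" by (simp add: c norm_scaleC)
    also have "\<dots> \<le> norm p * (norm y * norm a) * norm p"
      by (intro order_trans[OF norm_mult_ineq] mult_mono mult_nonneg_nonneg norm_mult_ineq) auto
    also have "\<dots> = (norm a * norm p * norm y) * norm p" by simp
    finally have "cmod c \<le> norm a * norm p * norm y" using p0 by (rule mult_right_le_imp_le)
    then have "cmod c * cmod \<alpha> \<le> norm a * norm p * norm y * cmod \<alpha>" by (rule mult_right_mono) simp
    moreover have "T (y * a * p) = c * \<alpha>" using P(3)[OF p c] .
    ultimately show ?thesis by (simp add: norm_mult mult_ac)
  qed
  have "cmod (T (y * a)) \<le> (\<Sum>p\<in>P. cmod \<alpha> * norm a * norm p) * norm y" for y
    unfolding P(2)[of y] sum_distrib_right using bound by (intro sum_norm_le) auto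
  moreover have "(\<Sum>p\<in>P. cmod \<alpha> * norm a * norm p) \<ge> 0" by (intro sum_nonneg) simp
  ultimately show ?thesis by blast
qed

end

section \<open>The normalized functional as a dimension count; rank-attaining elements near
  1\<close>

locale normalized_functional = constant_on_minimal a T 1 for a :: "'a::complex_banach_algebra" and T
begin

lemma exists_near_avoiding:
  fixes l :: complex
  assumes "finite F" "r > 0" shows "\<exists>t. t \<notin> F \<and> dist t l < r"
proof -
  have "infinite (ball l r)"
    using assms(2) uncountable_ball[of r l] countable_finite by blast
  then have "\<not> ball l r \<subseteq> F" using assms(1) finite_subset by blast
  then show ?thesis by (auto simp: dist_commute)
qed

text \<open>Schur triangularization: split off an eigenvector \<open>e\<close> of \<open>g\<close>, perturb the rest by induction
  and move the eigenvalue of \<open>e\<close> slightly. The value of \<open>T\<close> on \<open>q\<close> plays the role of the rank.\<close>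

lemma perturb_to_distinct_eigenvalues:
  assumes "q * q = q" "q = w * a" "T q = of_nat k" "q * g = g" "g * q = g" "d > 0"
  shows "\<exists>h. q * h = h \<and> h * q = h \<and> norm h < d \<and> k \<le> card (nonzero_spectrum (g + h))"
  using assms
proof (induction k arbitrary: q w g d)
  case 0
  then show ?case by (intro exI[of _ 0]) simp
next
  case (Suc k)
  note q = Suc.prems(1,2) and g = Suc.prems(4,5)
  have "q \<noteq> 0" using Suc.prems(3) T_zero by (auto simp del: of_nat_Suc)
  then obtain e l where e: "minimal_idempotent e" "q * e = e" "e * q = e" "g * e = l *\<^sub>C e"
    using eigen_idempotent[OF ss socle q(1) _ q(2) g] by blast
  have ee: "e * e = e" "e \<noteq> 0" using e(1) by (auto simp: minimal_idempotent_def)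
  have ea: "e = (e * w) * a" using e(3) q(2) by (simp add: mult.assoc)
  have Te: "T e = 1" using T_minimal[of "e * w"] ea e(1) by simp
  \<comment> \<open>Removing e lowers the value of T by one, so the induction hypothesis applies to
    the corner of q'.\<close>
  define q' where "q' = q - e"
  have q': "q' * q' = q'" "q' * e = 0" "e * q' = 0" using q e ee by (simp_all add: q'_def algebra_simps)
  have q'a: "q' = ((1 - e) * w) * a" using q e(3) by (simp add: q'_def algebra_simps)
  have Tq': "T q' = of_nat k"
    using T_diff[of w "e * w"] ea q(2) Te Suc.prems(3) unfolding q'_def by simp
  define g' where "g' = q' * g * q'"
  have g': "q' * g' = g'" "g' * q' = g'" using q'(1) by (simp_all add: g'_def mult.assoc) (simp add: q'(1) flip: mult.assoc)
  have "d / 2 > 0" using Suc.prems(6) by simp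
  then obtain h' where h': "q' * h' = h'" "h' * q' = h'" "norm h' < d / 2"
    and card_h': "k \<le> card (nonzero_spectrum (g' + h'))"
    using Suc.IH[OF q'(1) q'a Tq' g'] by blast
  define k0 where "k0 = g' + h'"
  have k0: "k0 * q' = k0" "q' * k0 = k0" using g' h' by (simp_all add: k0_def algebra_simps)
  have k0e: "k0 * e = 0" using k0(1) q'(2) by (metis mult.assoc mult_zero_right)
  define F where "F = nonzero_spectrum k0"
  have "k0 = (k0 * ((1 - e) * w)) * a" using k0(1) q'a by (simp add: mult.assoc)
  then have finF: "finite F" unfolding F_def by (metis rank_bound(1)[OF n])
  have "norm e > 0" using ee by simp
  then have "d / (2 * norm e) > 0" using Suc.prems(6) by simp
  \<comment> \<open>Avoiding 0 and F makes t a new nonzero spectral value; moving l to t costs less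
    than d / 2.\<close>
  then obtain t where t: "t \<notin> insert 0 F" "dist t l < d / (2 * norm e)"
    using exists_near_avoiding[of "insert 0 F"] finF by blast
  define h where "h = h' + (t - l) *\<^sub>C e"
  have qq': "q * q' = q'" "q' * q = q'" using q e by (simp_all add: q'_def algebra_simps)
  have h: "q * h = h" "h * q = h"
  proof -
    have "q * h' = h'" "h' * q = h'" using h' qq' by (metis mult.assoc)+
    then show "q * h = h" "h * q = h" using e by (simp_all add: h_def algebra_simps)
  qed
  have "norm ((t - l) *\<^sub>C e) < d / 2"
    unfolding norm_scaleC using t(2) \<open>norm e > 0\<close> by (simp add: dist_norm field_simps)
  then have nh: "norm h < d" using h'(3) norm_triangle_ineq[of h' "(t - l) *\<^sub>C e"] by (simp add: h_def)
  \<comment> \<open>Block form: g e = l e makes the entry q' g e below the diagonal vanish, and n0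
    is the entry above it.\<close>
  define n0 where "n0 = e * g * q'"
  have "g = q * g * q" using g by (simp add: mult.assoc)
  also have "\<dots> = (e + q') * g * (e + q')" by (simp add: q'_def)
  also have "\<dots> = e * (g * e) + n0 + q' * (g * e) + g'" by (simp add: n0_def g'_def algebra_simps)
  also have "\<dots> = l *\<^sub>C e + n0 + g'" using e(4) ee q' by simp
  finally have gh: "g + h = t *\<^sub>C e + n0 + k0" by (simp add: h_def k0_def algebra_simps)
  have n0e: "n0 * e = 0" "e * n0 = n0" using q' ee by (simp_all add: n0_def mult.assoc) (simp add: ee flip: mult.assoc)
  have k0n0: "k0 * n0 = 0" using k0e n0e(2) by (metis mult.assoc mult_zero_left)
  have t0: "t \<noteq> 0" "t \<notin> F" using t(1) by auto
  \<comment> \<open>Moving the left factor e to the right end removes the off-diagonal part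
    n0.\<close>
  have sp: "nonzero_spectrum (t *\<^sub>C e + n0) = {t}"
  proof -
    have "t *\<^sub>C e + n0 = e * (t *\<^sub>C e + n0)" using ee n0e by (simp add: algebra_simps)
    then have "nonzero_spectrum (t *\<^sub>C e + n0) = nonzero_spectrum ((t *\<^sub>C e + n0) * e)"
      using nonzero_spectrum_swap by metis
    also have "(t *\<^sub>C e + n0) * e = t *\<^sub>C e" using ee n0e by (simp add: algebra_simps)
    finally show ?thesis using nonzero_spectrum_idempotent[OF ee] t0 by auto
  qed
  have "insert t F \<subseteq> nonzero_spectrum (g + h)"
  proof
    fix m assume "m \<in> insert t F"
    then consider "m = t" | "m \<in> F" "m \<noteq> t" using t0 by blast
    then show "m \<in> nonzero_spectrum (g + h)"
    proof cases
      case 1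
      have "(g + h) * e = t *\<^sub>C e" unfolding gh using ee n0e k0e by (simp add: algebra_simps)
      then show ?thesis using 1 ee t0 by (intro eigenvalue_in_nonzero_spectrum) auto
    next
      case 2
      then have m: "m \<noteq> 0" "\<not> invertible_elem (1 - inverse m *\<^sub>C k0)"
        by (auto simp: F_def nonzero_spectrum_iff)
      have "m \<notin> nonzero_spectrum (t *\<^sub>C e + n0)" using sp 2 by simp
      then have inv: "invertible_elem (1 - inverse m *\<^sub>C (t *\<^sub>C e + n0))" using m(1) by (simp add: nonzero_spectrum_iff)
      \<comment> \<open>k0 annihilates t e + n0 from the left, so no cross term appears.\<close>
      have "(1 - inverse m *\<^sub>C k0) * (1 - inverse m *\<^sub>C (t *\<^sub>C e + n0)) = 1 - inverse m *\<^sub>C (g + h)"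
        unfolding gh using k0e k0n0 by (simp add: algebra_simps)
      then have "\<not> invertible_elem (1 - inverse m *\<^sub>C (g + h))"
        using invertible_elem_cancel_right[OF _ inv] m(2) by metis
      then show ?thesis using m(1) by (simp add: nonzero_spectrum_iff)
    qed
  qed
  moreover have "finite (nonzero_spectrum (g + h))"
  proof -
    have "g + h = ((g + h) * w) * a" using g h q(2) by (simp add: mult.assoc distrib_right)
    then show ?thesis by (metis rank_bound(1)[OF n])
  qed
  ultimately have "card (insert t F) \<le> card (nonzero_spectrum (g + h))" by (rule card_mono[rotated])
  then have "Suc k \<le> card (nonzero_spectrum (g + h))"
    using card_h' finF t0 by (simp add: F_def k0_def)
  then show ?case using h nh by blast
qed

text \<open>With q = v a, the element x = 1 + h v satisfies q x a = q a + h: a small perturbation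
  inside q A q is realized by moving x slightly away from 1.\<close>

lemma rank_attaining_near_one:
  assumes "d > 0" shows "\<exists>x. x \<in> rank_attaining a \<and> x \<in> ball 1 d"
proof -
  obtain x where x: "x \<in> rank_attaining a" using rank_attaining_nonempty[OF n] by blast
  obtain P where P: "orthogonal_idempotents P" "card P = n" "\<And>p. p \<in> P \<Longrightarrow> minimal_idempotent p"
    "\<And>p. p \<in> P \<Longrightarrow> \<exists>y. p = y * a" "a * \<Sum>P = a"
    by (rule diagonalization[OF ss n x]) blast
  obtain Y where Y: "\<And>p. p \<in> P \<Longrightarrow> p = Y p * a" using P(4) by metis
  define q v where "q = \<Sum>P" and "v = (\<Sum>p\<in>P. Y p)"
  have q: "q * q = q" unfolding q_def by (rule orthogonal_idempotents_sum_idem[OF P(1)])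
  have "q = (\<Sum>p\<in>P. Y p * a)" unfolding q_def using Y by (intro sum.cong) auto
  then have qv: "q = v * a" and "T q = (\<Sum>p\<in>P. T (Y p * a))"
    using T_sum[of Y P] by (simp_all add: v_def sum_distrib_right)
  moreover have "T (Y p * a) = 1" if "p \<in> P" for p
    using T_minimal[of "Y p"] Y[OF that] P(3)[OF that] by simp
  ultimately have Tq: "T q = of_nat n" using P(2) by simp
  have aq: "a * q = a" using P(5) by (simp add: q_def)
  have g: "q * (q * a) = q * a" "(q * a) * q = q * a" using q aq by (simp_all flip: mult.assoc) (simp add: mult.assoc)
  have "d / (norm v + 1) > 0" using assms norm_ge_zero[of v] by (intro divide_pos_pos) linarith+
  then obtain h where h: "q * h = h" "h * q = h" "norm h < d / (norm v + 1)"
    and card: "n \<le> card (nonzero_spectrum (q * a + h))"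
    using perturb_to_distinct_eigenvalues[OF q qv Tq g] by blast
  define x where "x = 1 + h * v"
  have "x * a = (x * a) * q" using aq by (simp add: mult.assoc)
  then have "nonzero_spectrum (x * a) = nonzero_spectrum (q * (x * a))" using nonzero_spectrum_swap by metis
  also have "q * (x * a) = q * a + (q * h) * (v * a)" by (simp add: x_def algebra_simps)
  also have "\<dots> = q * a + h" using h qv by simp
  finally have "x \<in> rank_attaining a"
    using card rank_bound(2)[OF n, of x] by (simp add: rank_attaining_iff[OF n])
  moreover have "x \<in> ball 1 d"
  proof -
    have "norm (h * v) \<le> norm h * norm v" by (rule norm_mult_ineq)
    also have "\<dots> \<le> norm h * (norm v + 1)" by (intro mult_left_mono) auto
    also have "\<dots> < d"
      using h(3) norm_ge_zero[of v] by (simp add: pos_less_divide_eq add_nonneg_pos)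
    finally show ?thesis by (simp add: x_def dist_norm)
  qed
  ultimately show ?thesis by blast
qed

end

subsection \<open>Spectra and traces of nearby elements\<close>

lemma spectrum_norm_le:
  fixes x :: "'a::complex_banach_algebra"
  assumes "c \<in> spectrum x" shows "cmod c \<le> norm x"
proof (rule ccontr)
  assume *: "\<not> cmod c \<le> norm x"
  then have "c \<noteq> 0" by auto
  then have "norm (inverse c *\<^sub>C x) < 1"
    unfolding norm_scaleC norm_inverse using * by (simp add: inverse_eq_divide)
  then have "c \<notin> nonzero_spectrum x"
    using invertible_elem_one_minus by (auto simp: nonzero_spectrum_iff)
  then show False using assms \<open>c \<noteq> 0\<close> by (simp add: nonzero_spectrum_def)
qed

text \<open>Away from the spectrum the resolvent of a is bounded on a compact set, so 1 - R l * (d *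
  a) stays invertible for small d = x - 1.\<close>

lemma spectrum_upper_semicontinuous:
  fixes a :: "'a::complex_banach_algebra"
  assumes "r > 0"
  shows "\<exists>e>0. \<forall>x\<in>ball 1 e. \<forall>l\<in>spectrum (x * a). \<exists>k\<in>spectrum a. dist l k < r"
proof -
  \<comment> \<open>For norm (x - 1) < 1 the spectrum of x a lies in the disk of radius 2 * norm
    a.\<close>
  define K where "K = cball (0::complex) (2 * norm a) - (\<Union>k\<in>spectrum a. ball k r)"
  have "compact K" unfolding K_def by (intro compact_diff compact_cball open_UN) auto
  define R where "R l = inverse_elem (l *\<^sub>C 1 - a)" for l
  have inv: "invertible_elem (l *\<^sub>C 1 - a)" if "l \<in> K" for l
  proof -
    have "l \<notin> spectrum a" using that assms by (auto simp: K_def)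
    then show ?thesis by (simp add: spectrum_def)
  qed
  have "continuous_on K R"
    unfolding R_def
    by (intro continuous_on_compose2[OF continuous_on_inverse_elem] continuous_intros)
      (use inv in auto)
  then have "bounded (R ` K)" using \<open>compact K\<close> by (intro compact_imp_bounded compact_continuous_image)
  then obtain M where M: "M > 0" "\<And>l. l \<in> K \<Longrightarrow> norm (R l) \<le> M"
    unfolding bounded_pos by auto
  define e where "e = min 1 (1 / (M * (norm a + 1)))"
  have e: "e > 0" using M norm_ge_zero[of a] by (simp add: e_def add_nonneg_pos)
  have "\<exists>k\<in>spectrum a. dist l k < r" if x: "x \<in> ball 1 e" and l: "l \<in> spectrum (x * a)" for x l
  proof (rule ccontr)
    assume "\<not> ?thesis"
    then have far: "l \<notin> (\<Union>k\<in>spectrum a. ball k r)" by (auto simp: dist_commute)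
    define d where "d = x - 1"
    have nd: "norm d < e" using x by (simp add: d_def dist_norm norm_minus_commute)
    have xa: "x * a = a + d * a" by (simp add: d_def algebra_simps)
    have "norm (d * a) \<le> norm d * norm a" by (rule norm_mult_ineq)
    also have "\<dots> \<le> 1 * norm a" using nd by (intro mult_right_mono) (auto simp: e_def)
    finally have "norm (x * a) \<le> 2 * norm a" unfolding xa using norm_triangle_ineq[of a "d * a"] by simp
    then have "l \<in> K" using spectrum_norm_le[OF l] far by (simp add: K_def)
    have "norm (R l * (d * a)) \<le> norm (R l) * norm (d * a)" by (rule norm_mult_ineq)
    also have "\<dots> \<le> M * (norm d * norm a)"
      using M \<open>l \<in> K\<close> norm_mult_ineq[of d a] by (intro mult_mono) auto
    also have "\<dots> \<le> norm d * (M * (norm a + 1))"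
      using M(1) by (simp add: algebra_simps)
    also have "\<dots> < 1"
      using nd M(1) norm_ge_zero[of a] by (simp add: e_def pos_less_divide_eq add_nonneg_pos)
    finally have "invertible_elem (1 - R l * (d * a))" by (rule invertible_elem_one_minus)
    then have "invertible_elem ((l *\<^sub>C 1 - a) * (1 - R l * (d * a)))"
      using inv[OF \<open>l \<in> K\<close>] by (intro invertible_elem_mult)
    moreover have "(l *\<^sub>C 1 - a) * (1 - R l * (d * a)) = (l *\<^sub>C 1 - a) - ((l *\<^sub>C 1 - a) * R l) * (d * a)"
      by (simp only: right_diff_distrib mult_1_right mult.assoc)
    then have "(l *\<^sub>C 1 - a) * (1 - R l * (d * a)) = l *\<^sub>C 1 - x * a"
      unfolding R_def inverse_elem(1)[OF inv[OF \<open>l \<in> K\<close>]] by (simp add: xa)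
    ultimately show False using l by (simp add: spectrum_def)
  qed
  then show ?thesis using e by blast
qed

lemma continuous_on_aeval [continuous_intros]:
  assumes "continuous_on S f" shows "continuous_on S (\<lambda>x. aeval G (f x))"
  using assms by (induction G) (auto intro!: continuous_intros)

section \<open>Multiplicities as values of the functional\<close>

context normalized_functional
begin

text \<open>G(0) = 0 puts G (x a) into A a, so it decomposes along P; on each p, x a acts as the
  scalar \<open>c p\<close>.\<close>

lemma T_aeval:
  assumes x: "x \<in> rank_attaining a" and G: "poly G 0 = 0"
  shows "T (aeval G (x * a)) = (\<Sum>l\<in>nonzero_spectrum (x * a). poly G l)"
proof -
  obtain P c where P: "orthogonal_idempotents P" "\<And>p. p \<in> P \<Longrightarrow> minimal_idempotent p"
    "\<And>p. p \<in> P \<Longrightarrow> \<exists>y. p = y * a" "a * \<Sum>P = a"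
    and xa: "x * a = (\<Sum>p\<in>P. c p *\<^sub>C p)" "inj_on c P" "c ` P = nonzero_spectrum (x * a)"
    by (rule diagonalization[OF ss n x]) blast
  obtain Y where Y: "\<And>p. p \<in> P \<Longrightarrow> p = Y p * a" using P(3) by metis
  have finP: "finite P" using P(1) by (simp add: orthogonal_idempotents_def)
  have bp: "x * a * p = c p *\<^sub>C p" if "p \<in> P" for p
  proof -
    have "x * a * p = (\<Sum>p'\<in>P. if p' = p then c p *\<^sub>C p else 0)"
      unfolding xa(1) sum_distrib_right using P(1) that
      by (intro sum.cong) (auto simp: orthogonal_idempotents_def)
    then show ?thesis using finP that by simp
  qed
  have Gp: "aeval H (x * a) * p = poly H (c p) *\<^sub>C p" if "p \<in> P" for H p
  proof (induction H)
    case (pCons d H)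
    have "aeval (pCons d H) (x * a) * p = d *\<^sub>C p + x * a * (aeval H (x * a) * p)"
      by (simp add: distrib_right mult.assoc)
    then show ?case using pCons.IH bp[OF that] by (simp add: algebra_simps)
  qed simp
  obtain F where F: "G = pCons 0 F" using G by (metis pCons_cases poly_pCons mult_zero_left add.right_neutral)
  have "aeval G (x * a) = aeval F (x * a) * (x * a)"
    unfolding F using aeval_commute[of "x * a" "x * a" F] by simp
  then have "aeval G (x * a) = aeval G (x * a) * \<Sum>P" using P(4) by (simp add: mult.assoc)
  also have "\<dots> = (\<Sum>p\<in>P. poly G (c p) *\<^sub>C p)" unfolding sum_distrib_left using Gp by simp
  also have "\<dots> = (\<Sum>p\<in>P. (poly G (c p) *\<^sub>C Y p) * a)"
  proof (rule sum.cong)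
    fix p assume "p \<in> P"
    then show "poly G (c p) *\<^sub>C p = (poly G (c p) *\<^sub>C Y p) * a" using Y by (metis mult_scaleC_left)
  qed simp
  finally have "T (aeval G (x * a)) = (\<Sum>p\<in>P. T ((poly G (c p) *\<^sub>C Y p) * a))" using T_sum by metis
  also have "\<dots> = (\<Sum>p\<in>P. poly G (c p))"
  proof (rule sum.cong)
    fix p assume p: "p \<in> P"
    have "T (Y p * a) = 1" using T_minimal[of "Y p"] Y[OF p] P(2)[OF p] by simp
    then show "T ((poly G (c p) *\<^sub>C Y p) * a) = poly G (c p)" using T_scaleC by simp
  qed simp
  also have "\<dots> = (\<Sum>l\<in>nonzero_spectrum (x * a). poly G l)"
    unfolding xa(3)[symmetric] using xa(2) by (simp add: sum.reindex)
  finally show ?thesis .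
qed

text \<open>G (x a) = \<open>W x * a\<close> with W continuous in x, and T is bounded in terms of
  the cofactor \<open>W x\<close>.\<close>

lemma T_aeval_continuous:
  assumes G: "poly G 0 = 0" and e: "e > 0"
  shows "\<exists>d>0. \<forall>x\<in>ball 1 d. cmod (T (aeval G (x * a)) - T (aeval G a)) < e"
proof -
  obtain C where C: "C \<ge> 0" "\<And>y. cmod (T (y * a)) \<le> C * norm y" using T_bound by blast
  obtain F where F: "G = pCons 0 F" using G by (metis pCons_cases poly_pCons mult_zero_left add.right_neutral)
  define W where "W x = aeval F (x * a) * x" for x
  have W: "aeval G (x * a) = W x * a" for x
    unfolding F W_def using aeval_commute[of "x * a" "x * a" F] by (simp add: mult.assoc)
  have "continuous_on UNIV W" unfolding W_def by (intro continuous_intros)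
  then have "isCont W 1" by (simp add: continuous_on_eq_continuous_at)
  then obtain d where d: "d > 0" "\<And>x. dist x 1 < d \<Longrightarrow> dist (W x) (W 1) < e / (C + 1)"
    unfolding continuous_at_eps_delta using e C(1) by (metis add_nonneg_pos divide_pos_pos zero_less_one)
  have "cmod (T (aeval G (x * a)) - T (aeval G a)) < e" if "x \<in> ball 1 d" for x
  proof -
    have "T (aeval G (x * a)) - T (aeval G a) = T ((W x - W 1) * a)"
      using T_diff W[of 1] W[of x] by (simp add: left_diff_distrib)
    then have "cmod (T (aeval G (x * a)) - T (aeval G a)) \<le> C * norm (W x - W 1)" using C(2) by metis
    also have "\<dots> \<le> (C + 1) * norm (W x - W 1)" by (intro mult_right_mono) auto
    also have "\<dots> < e"
      using d(2)[of x] that C(1) by (simp add: dist_norm norm_minus_commute pos_less_divide_eq mult.commute)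
    finally show ?thesis .
  qed
  then show ?thesis using d(1) by blast
qed

definition "K = insert 0 (spectrum a)"

lemma finite_K: "finite K"
  using rank_bound(1)[OF n, of 1] by (simp add: K_def nonzero_spectrum_def)

text \<open>Spectral values of x a are replaced by nearby points of the fixed finite set K, where G
  can be prescribed. There are exactly n of them, each costing at most h.\<close>

lemma sum_over_nearest_points:
  assumes G: "poly G 0 = 0" and "e > 0" "r > 0"
  shows "\<exists>d>0. \<forall>x\<in>rank_attaining a \<inter> ball 1 d. \<exists>f. (\<forall>l\<in>nonzero_spectrum (x * a). f l \<in> K \<and> dist l (f l) < r) \<and>
    cmod ((\<Sum>l\<in>nonzero_spectrum (x * a). poly G (f l)) - T (aeval G a)) < e"
proof -
  define h where "h = e / (2 * (real n + 1))"
  have h: "h > 0" "real n * h \<le> e / 2" using \<open>e > 0\<close> by (simp_all add: h_def field_simps)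
  have "\<exists>s>0. \<forall>l. dist l k < s \<longrightarrow> dist (poly G l) (poly G k) < h" for k
  proof -
    have "isCont (poly G) k" by simp
    then show ?thesis using h(1) unfolding continuous_at_eps_delta by blast
  qed
  then obtain s where s: "\<And>k. s k > 0" "\<And>k l. dist l k < s k \<Longrightarrow> dist (poly G l) (poly G k) < h" by metis
  define t where "t = Min (insert r (s ` K))"
  have t: "t > 0" "t \<le> r" "\<And>k. k \<in> K \<Longrightarrow> t \<le> s k"
    using finite_K s(1) \<open>r > 0\<close> by (auto simp: t_def Min_gr_iff)
  obtain d1 where d1: "d1 > 0" "\<And>x l. x \<in> ball 1 d1 \<Longrightarrow> l \<in> spectrum (x * a) \<Longrightarrow> \<exists>k\<in>spectrum a. dist l k < t"
    using spectrum_upper_semicontinuous[OF t(1)] by metis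
  have "e / 2 > 0" using \<open>e > 0\<close> by simp
  then obtain d2 where d2: "d2 > 0" "\<And>x. x \<in> ball 1 d2 \<Longrightarrow> cmod (T (aeval G (x * a)) - T (aeval G a)) < e / 2"
    using T_aeval_continuous[OF G] by metis
  show ?thesis
  proof (intro exI[of _ "min d1 d2"] conjI ballI)
    show "min d1 d2 > 0" using d1(1) d2(1) by simp
    fix x assume "x \<in> rank_attaining a \<inter> ball 1 (min d1 d2)"
    then have x: "x \<in> rank_attaining a" "x \<in> ball 1 d1" "x \<in> ball 1 d2" by auto
    define L where "L = nonzero_spectrum (x * a)"
    have "\<forall>l\<in>L. \<exists>k. k \<in> K \<and> dist l k < t"
      using d1(2)[OF x(2)] by (auto simp: L_def nonzero_spectrum_def K_def)
    then obtain f where f: "\<And>l. l \<in> L \<Longrightarrow> f l \<in> K \<and> dist l (f l) < t" by metis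
    have "cmod ((\<Sum>l\<in>L. poly G (f l)) - T (aeval G (x * a))) = cmod (\<Sum>l\<in>L. poly G (f l) - poly G l)"
      using T_aeval[OF x(1) G] by (simp add: L_def sum_subtractf)
    also have "\<dots> \<le> of_nat (card L) * h"
    proof (rule sum_norm_bound)
      fix l assume "l \<in> L"
      then have "dist l (f l) < s (f l)" using f t(3) less_le_trans by blast
      then show "cmod (poly G (f l) - poly G l) \<le> h"
        using s(2) by (metis dist_commute dist_norm less_imp_le)
    qed
    also have "\<dots> = real n * h" using x(1) by (simp add: L_def rank_attaining_iff[OF n])
    finally have "cmod ((\<Sum>l\<in>L. poly G (f l)) - T (aeval G (x * a))) \<le> e / 2" using h(2) by simp
    then have "cmod ((\<Sum>l\<in>L. poly G (f l)) - T (aeval G a)) < e"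
      using d2(2)[OF x(3)] norm_triangle_ineq[of "(\<Sum>l\<in>L. poly G (f l)) - T (aeval G (x * a))" "T (aeval G (x * a)) - T (aeval G a)"]
      by simp
    then show "\<exists>f. (\<forall>l\<in>nonzero_spectrum (x * a). f l \<in> K \<and> dist l (f l) < r) \<and>
      cmod ((\<Sum>l\<in>nonzero_spectrum (x * a). poly G (f l)) - T (aeval G a)) < e"
      using f t(2) unfolding L_def by (intro exI[of _ f]) (meson less_le_trans)
  qed
qed

text \<open>The approximating sums are all 0, so the modulus of \<open>T (aeval G a)\<close>, taken
  as tolerance, would be smaller than itself at a rank-attaining element near 1.\<close>

lemma T_aeval_vanishing:
  assumes "\<And>k. k \<in> K \<Longrightarrow> poly G k = 0"
  shows "T (aeval G a) = 0"
proof (rule ccontr)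
  assume "T (aeval G a) \<noteq> 0"
  then have "cmod (T (aeval G a)) > 0" by simp
  moreover have "poly G 0 = 0" using assms by (simp add: K_def)
  ultimately obtain d where "d > 0" and d: "\<forall>x\<in>rank_attaining a \<inter> ball 1 d. \<exists>f. (\<forall>l\<in>nonzero_spectrum (x * a). f l \<in> K \<and> dist l (f l) < 1) \<and>
    cmod ((\<Sum>l\<in>nonzero_spectrum (x * a). poly G (f l)) - T (aeval G a)) < cmod (T (aeval G a))"
    using sum_over_nearest_points[of G "cmod (T (aeval G a))" 1] by auto
  then obtain x where "x \<in> rank_attaining a \<inter> ball 1 d" using rank_attaining_near_one by blast
  with d obtain f where f: "\<forall>l\<in>nonzero_spectrum (x * a). f l \<in> K"
    "cmod ((\<Sum>l\<in>nonzero_spectrum (x * a). poly G (f l)) - T (aeval G a)) < cmod (T (aeval G a))" by blast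
  have "(\<Sum>l\<in>nonzero_spectrum (x * a). poly G (f l)) = 0"
    using f(1) assms by (intro sum.neutral) blast
  then show False using f(2) by simp
qed

text \<open>G is the indicator of c on K, so the approximating sum counts the spectral values
  assigned to c.\<close>

lemma card_near_point:
  assumes c: "c \<in> nonzero_spectrum a" and G: "poly G c = 1" "\<And>k. k \<in> K - {c} \<Longrightarrow> poly G k = 0"
    and r: "r > 0" "\<And>k. k \<in> K - {c} \<Longrightarrow> 2 * r \<le> dist k c" and e: "e > 0"
  shows "\<exists>d>0. \<forall>x\<in>rank_attaining a \<inter> ball 1 d.
    cmod (of_nat (card (nonzero_spectrum (x * a) \<inter> ball c r)) - T (aeval G a)) < e"
proof -
  have "poly G 0 = 0" using c G(2) by (simp add: K_def nonzero_spectrum_def)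
  then obtain d where "d > 0" and d: "\<forall>x\<in>rank_attaining a \<inter> ball 1 d. \<exists>f. (\<forall>l\<in>nonzero_spectrum (x * a). f l \<in> K \<and> dist l (f l) < r) \<and>
    cmod ((\<Sum>l\<in>nonzero_spectrum (x * a). poly G (f l)) - T (aeval G a)) < e"
    using sum_over_nearest_points[of G e r] e r(1) by auto
  have "cmod (of_nat (card (nonzero_spectrum (x * a) \<inter> ball c r)) - T (aeval G a)) < e"
    if x: "x \<in> rank_attaining a \<inter> ball 1 d" for x
  proof -
    obtain f where f: "\<And>l. l \<in> nonzero_spectrum (x * a) \<Longrightarrow> f l \<in> K \<and> dist l (f l) < r"
      "cmod ((\<Sum>l\<in>nonzero_spectrum (x * a). poly G (f l)) - T (aeval G a)) < e" using x d by blast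
    \<comment> \<open>The gap 2 r between c and the rest of K makes membership in
      \<open>ball c r\<close> equivalent to f l = c.\<close>
    have "poly G (f l) = (if l \<in> ball c r then 1 else 0)" if l: "l \<in> nonzero_spectrum (x * a)" for l
    proof (cases "f l = c")
      case True
      then show ?thesis using f(1)[OF l] G(1) by (simp add: dist_commute)
    next
      case False
      then have "f l \<in> K - {c}" using f(1)[OF l] by simp
      then have "2 * r \<le> dist (f l) c" "poly G (f l) = 0" using r(2) G(2) by auto
      moreover have "dist (f l) c \<le> dist l (f l) + dist l c" by (metis dist_commute dist_triangle)
      ultimately show ?thesis using f(1)[OF l] by (auto simp: dist_commute)
    qed
    then have "(\<Sum>l\<in>nonzero_spectrum (x * a). poly G (f l)) = (\<Sum>l\<in>nonzero_spectrum (x * a). if l \<in> ball c r then 1 else 0)"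
      by (intro sum.cong) auto
    also have "\<dots> = of_nat (card (nonzero_spectrum (x * a) \<inter> ball c r))"
      using rank_bound(1)[OF n, of x] by (subst sum.If_cases) (auto simp: ball_def)
    finally show ?thesis using f(2) by simp
  qed
  then show ?thesis using \<open>d > 0\<close> by blast
qed

lemma separating_radius:
  assumes "r0 > 0" "\<And>k. k \<in> K - {c} \<Longrightarrow> b k > 0"
  obtains r where "r > 0" "r \<le> r0" "\<And>k. k \<in> K - {c} \<Longrightarrow> 2 * r \<le> dist k c" "\<And>k. k \<in> K - {c} \<Longrightarrow> r \<le> b k"
proof -
  define r where "r = Min (insert r0 ((\<lambda>k. min (b k) (dist k c / 2)) ` (K - {c})))"
  have fin: "finite (insert r0 ((\<lambda>k. min (b k) (dist k c / 2)) ` (K - {c})))" using finite_K by simp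
  have "r > 0" unfolding r_def using fin assms by (subst Min_gr_iff) auto
  moreover have "r \<le> r0" unfolding r_def using fin by (intro Min_le) auto
  moreover have "r \<le> min (b k) (dist k c / 2)" if "k \<in> K - {c}" for k
    unfolding r_def using fin that by (intro Min_le) auto
  ultimately show ?thesis by (intro that[of r]) force+
qed

text \<open>Natural numbers approximate the value arbitrarily well; two of them within 1/2 of it
  coincide, so the first error cannot be improved and is 0.\<close>

lemma T_aeval_is_nat:
  assumes c: "c \<in> nonzero_spectrum a" and G: "poly G c = 1" "\<And>k. k \<in> K - {c} \<Longrightarrow> poly G k = 0"
  shows "\<exists>N. T (aeval G a) = of_nat N"
proof -
  obtain r where r: "r > 0" "\<And>k. k \<in> K - {c} \<Longrightarrow> 2 * r \<le> dist k c"
    by (rule separating_radius[of 1 c "\<lambda>_. 1"]) auto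
  have approx: "\<exists>N. cmod (of_nat N - T (aeval G a)) < e" if e: "e > 0" for e
  proof -
    obtain d where "d > 0" "\<forall>x\<in>rank_attaining a \<inter> ball 1 d.
      cmod (of_nat (card (nonzero_spectrum (x * a) \<inter> ball c r)) - T (aeval G a)) < e"
      using card_near_point[OF c G(1) _ r(1) _ e] G(2) r(2) by blast
    then show ?thesis using rank_attaining_near_one by blast
  qed
  obtain N where N: "cmod (of_nat N - T (aeval G a)) < 1/2" using approx[of "1/2"] by auto
  have "T (aeval G a) = of_nat N"
  proof (rule ccontr)
    assume "T (aeval G a) \<noteq> of_nat N"
    then have "cmod (of_nat N - T (aeval G a)) > 0" by simp
    then obtain N' where N': "cmod (of_nat N' - T (aeval G a)) < cmod (of_nat N - T (aeval G a))"
      using approx by blast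
    have "cmod (of_nat N - of_nat N') < 1"
      using N N' norm_triangle_ineq4[of "of_nat N - T (aeval G a)" "of_nat N' - T (aeval G a)"] by simp
    then have "cmod (of_int (int N - int N')) < 1" by simp
    then have "\<bar>int N - int N'\<bar> < 1" by (simp only: norm_of_int of_int_abs[symmetric] of_int_less_1_iff)
    then show False using N' by simp
  qed
  then show ?thesis by blast
qed

lemma spectral_multiplicity_eq:
  assumes c: "c \<in> nonzero_spectrum a" and G: "poly G c = 1" "\<And>k. k \<in> K - {c} \<Longrightarrow> poly G k = 0"
  shows "of_nat (spectral_multiplicity c a) = T (aeval G a)"
proof -
  obtain N where N: "T (aeval G a) = of_nat N" using T_aeval_is_nat[OF c G] by blast
  have cK: "c \<in> K" "c \<noteq> 0" "c \<in> spectrum a" using c by (auto simp: K_def nonzero_spectrum_def)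
  have ex: "\<exists>e>0. \<forall>x\<in>rank_attaining a \<inter> ball 1 e. ecard (spectrum (x * a) \<inter> ball c r) = enat N"
    if r: "r > 0" "cball c r \<inter> spectrum a \<subseteq> {c}" for r
  proof -
    \<comment> \<open>For another spectral value k, b k is its distance to \<open>cball c r\<close>.
      If 0 is outside the spectrum of a it may lie in that disk; then 1 is a placeholder, and 2 s <=
      cmod c keeps 0 out.\<close>
    define b where "b k = (if k \<in> spectrum a then dist k c - r else 1)" for k
    have "b k > 0" if "k \<in> K - {c}" for k
      using r(2) that by (auto simp: b_def dist_commute subset_iff not_le[symmetric])
    then obtain s where s: "s > 0" "s \<le> r" "\<And>k. k \<in> K - {c} \<Longrightarrow> 2 * s \<le> dist k c" "\<And>k. k \<in> K - {c} \<Longrightarrow> s \<le> b k"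
      by (rule separating_radius[OF r(1)]) auto
    obtain d1 where d1: "d1 > 0" "\<And>x l. x \<in> ball 1 d1 \<Longrightarrow> l \<in> spectrum (x * a) \<Longrightarrow> \<exists>k\<in>spectrum a. dist l k < s"
      using spectrum_upper_semicontinuous[OF s(1)] by metis
    obtain d2 where d2: "d2 > 0" "\<And>x. x\<in>rank_attaining a \<inter> ball 1 d2 \<Longrightarrow>
      cmod (of_nat (card (nonzero_spectrum (x * a) \<inter> ball c s)) - T (aeval G a)) < 1"
      using card_near_point[OF c G(1) _ s(1), of 1] G(2) s(3) by (metis zero_less_one)
    have "ecard (spectrum (x * a) \<inter> ball c r) = enat N"
      if x: "x \<in> rank_attaining a \<inter> ball 1 (min d1 d2)" for x
    proof -
      have eq: "spectrum (x * a) \<inter> ball c r = nonzero_spectrum (x * a) \<inter> ball c s"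
      proof (intro equalityI subsetI)
        fix l assume l: "l \<in> spectrum (x * a) \<inter> ball c r"
        obtain k where k: "k \<in> spectrum a" "dist l k < s" using d1(2)[of x l] x l by auto
        have "k = c"
        proof (rule ccontr)
          assume "k \<noteq> c"
          then have "s \<le> dist k c - r" using s(4)[of k] k(1) by (simp add: b_def K_def)
          moreover have "dist k c \<le> dist l k + dist l c" by (metis dist_commute dist_triangle)
          ultimately show False using k(2) l by (simp add: dist_commute)
        qed
        moreover have "2 * s \<le> dist 0 c" using s(3)[of 0] cK by (simp add: K_def)
        ultimately have "l \<noteq> 0" using k(2) s(1) by auto
        then show "l \<in> nonzero_spectrum (x * a) \<inter> ball c s"
          using l k(2) \<open>k = c\<close> by (simp add: nonzero_spectrum_def dist_commute)
      next
        fix l assume "l \<in> nonzero_spectrum (x * a) \<inter> ball c s"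
        then show "l \<in> spectrum (x * a) \<inter> ball c r" using s(2) by (simp add: nonzero_spectrum_def)
      qed
      define M where "M = card (nonzero_spectrum (x * a) \<inter> ball c s)"
      have "cmod (of_nat M - of_nat N) < 1" using d2(2)[of x] x N by (simp add: M_def)
      then have "cmod (of_int (int M - int N)) < 1" by simp
      then have "\<bar>int M - int N\<bar> < 1" by (simp only: norm_of_int of_int_abs[symmetric] of_int_less_1_iff)
      then have "M = N" by simp
      then show ?thesis unfolding eq ecard_def using rank_bound(1)[OF n, of x] by (simp add: M_def)
    qed
    then show ?thesis using d1(1) d2(1) by (intro exI[of _ "min d1 d2"]) auto
  qed
  have "spectral_multiplicity c a = N"
    unfolding spectral_multiplicity_def
  proof (rule the_equality)
    show "\<forall>r>0. cball c r \<inter> spectrum a \<subseteq> {c} \<longrightarrow>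
      (\<exists>\<epsilon>>0. \<forall>x\<in>rank_attaining a \<inter> ball 1 \<epsilon>. ecard (spectrum (x * a) \<inter> ball c r) = enat N)"
      using ex by blast
    fix M assume M: "\<forall>r>0. cball c r \<inter> spectrum a \<subseteq> {c} \<longrightarrow>
      (\<exists>\<epsilon>>0. \<forall>x\<in>rank_attaining a \<inter> ball 1 \<epsilon>. ecard (spectrum (x * a) \<inter> ball c r) = enat M)"
    obtain r where r: "r > 0" "\<And>k. k \<in> K - {c} \<Longrightarrow> 2 * r \<le> dist k c"
      by (rule separating_radius[of 1 c "\<lambda>_. 1"]) auto
    have sub: "cball c r \<inter> spectrum a \<subseteq> {c}"
    proof
      fix k assume k: "k \<in> cball c r \<inter> spectrum a"
      show "k \<in> {c}"
      proof (rule ccontr)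
        assume "k \<notin> {c}"
        then have "2 * r \<le> dist k c" using r(2)[of k] k by (simp add: K_def)
        then show False using k r(1) by (simp add: dist_commute)
      qed
    qed
    obtain e1 where e1: "e1 > 0" "\<And>x. x\<in>rank_attaining a \<inter> ball 1 e1 \<Longrightarrow> ecard (spectrum (x * a) \<inter> ball c r) = enat M"
      using M r(1) sub by blast
    obtain e2 where e2: "e2 > 0" "\<And>x. x\<in>rank_attaining a \<inter> ball 1 e2 \<Longrightarrow> ecard (spectrum (x * a) \<inter> ball c r) = enat N"
      using ex[OF r(1) sub] by blast
    \<comment> \<open>A common rank-attaining point near 1 is what makes the two counts
      comparable.\<close>
    obtain x where x: "x \<in> rank_attaining a" "x \<in> ball 1 (min e1 e2)"
      using rank_attaining_near_one[of "min e1 e2"] e1(1) e2(1) by auto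
    then have "enat M = enat N" using e1(2)[of x] e2(2)[of x] by simp
    then show "M = N" by simp
  qed
  then show ?thesis using N by simp
qed

text \<open>X minus the sum of the c G_c vanishes on K, so T a is the sum of the c T (G_c (a)), and
  these values of T are the multiplicities; the point 0 adds nothing to the trace.\<close>

lemma socle_trace_eq: "socle_trace a = T a"
proof -
  have "\<exists>G. poly G c = 1 \<and> (\<forall>k\<in>K - {c}. poly G k = 0)" for c
    by (rule Lagrange_basis_polynomial[OF finite_K])
  then obtain G where G: "\<And>c. poly (G c) c = 1" "\<And>c k. k \<in> K - {c} \<Longrightarrow> poly (G c) k = 0" by metis
  have fin: "finite (spectrum a)" using finite_K by (simp add: K_def)
  define D where "D = [:0, 1:] - (\<Sum>c\<in>nonzero_spectrum a. smult c (G c))"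
  have fin': "finite (nonzero_spectrum a)" using fin by (simp add: nonzero_spectrum_def)
  have "poly D k = 0" if k: "k \<in> K" for k
  proof -
    have "(\<Sum>c\<in>nonzero_spectrum a. c * poly (G c) k) = (\<Sum>c\<in>nonzero_spectrum a. if c = k then k else 0)"
    proof (rule sum.cong)
      fix c
      show "c * poly (G c) k = (if c = k then k else 0)" using G(1) G(2)[of k c] k by auto
    qed simp
    also have "\<dots> = k" using k fin' by (auto simp: K_def nonzero_spectrum_def)
    finally show ?thesis by (simp add: D_def poly_sum)
  qed
  then have D0: "T (aeval D a) = 0" by (rule T_aeval_vanishing)
  have "\<exists>w. aeval (G c) a = w * a" if "c \<in> nonzero_spectrum a" for c
  proof -
    have "poly (G c) 0 = 0" using G(2)[of 0 c] that by (simp add: K_def nonzero_spectrum_def)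
    then obtain F where "G c = pCons 0 F" by (metis pCons_cases poly_pCons mult_zero_left add.right_neutral)
    then show ?thesis using aeval_commute[of a a F] by auto
  qed
  then obtain w where w: "\<And>c. c \<in> nonzero_spectrum a \<Longrightarrow> aeval (G c) a = w c * a" by metis
  have "aeval D a = 1 * a - (\<Sum>c\<in>nonzero_spectrum a. c *\<^sub>C w c) * a"
    using w by (simp add: D_def aeval_sum sum_distrib_right)
  then have "T a = T ((\<Sum>c\<in>nonzero_spectrum a. c *\<^sub>C w c) * a)"
    using D0 T_diff[of 1 "\<Sum>c\<in>nonzero_spectrum a. c *\<^sub>C w c"] by simp
  also have "\<dots> = (\<Sum>c\<in>nonzero_spectrum a. T ((c *\<^sub>C w c) * a))"
    using T_sum[of "\<lambda>c. c *\<^sub>C w c"] by (simp only: sum_distrib_right)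
  also have "\<dots> = (\<Sum>c\<in>nonzero_spectrum a. c * of_nat (spectral_multiplicity c a))"
  proof (rule sum.cong)
    fix c assume c: "c \<in> nonzero_spectrum a"
    have "of_nat (spectral_multiplicity c a) = T (w c * a)"
      using spectral_multiplicity_eq[OF c G(1)[of c] G(2)] w[OF c] by simp
    then show "T ((c *\<^sub>C w c) * a) = c * of_nat (spectral_multiplicity c a)" using T_scaleC[of c "w c"] by simp
  qed simp
  also have "\<dots> = socle_trace a"
    unfolding socle_trace_def nonzero_spectrum_def by (rule sum.mono_neutral_left) (use fin in auto)
  finally show ?thesis by simp
qed

end

text \<open>The scalar of p x p defines a normalized functional on A p; it agrees with the trace at
  p, where its value is 1.\<close>

lemma socle_trace_minimal_idempotent:
  fixes p :: "'a::complex_banach_algebra"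
  assumes ss: "semisimple TYPE('a)" and p: "minimal_idempotent p"
  shows "socle_trace p = 1"
proof -
  have pp: "p * p = p" "p \<noteq> 0" using p by (auto simp: minimal_idempotent_def)
  have "\<forall>x. \<exists>c. p * x * p = c *\<^sub>C p" using p by (simp add: minimal_idempotent_def)
  then obtain T where T: "\<And>x. p * x * p = T x *\<^sub>C p" by metis
  have uniq: "T x = c" if "p * x * p = c *\<^sub>C p" for x c
    using T[of x] that pp(2) by simp
  interpret normalized_functional p T
  proof
    show "semisimple TYPE('a)" by (rule ss)
    show "p \<in> socle" using minimal_idempotent_rank[OF p] by (auto simp: socle_iff one_enat_def)
    show "T (x * p + y * p) = T (x * p) + T (y * p)" for x y
      by (rule uniq) (simp add: T distrib_left distrib_right scaleC_add_left)
    show "T (c *\<^sub>C (x * p)) = c * T (x * p)" for c x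
      by (rule uniq) (simp add: T)
    show "T (y * p) = 1" if e: "minimal_idempotent (y * p)" for y
    proof -
      \<comment> \<open>The square of y p is T y times y p, so idempotence of the nonzero y p forces
        T y = 1.\<close>
      have "(y * p) * (y * p) = y * (p * y * p)" by (simp add: mult.assoc)
      then have "y * p = T y *\<^sub>C (y * p)" using e T[of y] by (simp add: minimal_idempotent_def)
      then have "(1 - T y) *\<^sub>C (y * p) = 0" by (simp add: algebra_simps)
      then have "T y = 1" using e by (auto simp: minimal_idempotent_def)
      moreover have "T (y * p) = T y" by (rule uniq) (simp add: T mult.assoc pp flip: T[of y])
      ultimately show ?thesis by simp
    qed
  qed
  have "T p = 1" by (rule uniq) (simp add: pp)
  then show ?thesis using socle_trace_eq by simp
qed

theorem theorem3p4:
  fixes f :: "'a::complex_banach_algebra \<Rightarrow> complex"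
  assumes "semisimple TYPE('a)"
    and "socle \<noteq> {0::'a}"
    and "linear_functional_on socle f"
  shows "(\<exists>\<alpha>. \<forall>a\<in>socle. f a = \<alpha> * socle_trace a) \<longleftrightarrow> f constant_on rank_one_projections"
proof
  assume "\<exists>\<alpha>. \<forall>a\<in>socle. f a = \<alpha> * socle_trace a"
  then obtain \<alpha> where \<alpha>: "\<And>a. a \<in> socle \<Longrightarrow> f a = \<alpha> * socle_trace a" by blast
  have "f p = \<alpha>" if "p \<in> rank_one_projections" for p
  proof -
    have "p \<in> socle" using that by (auto simp: rank_one_projections_def socle_iff one_enat_def)
    moreover have "minimal_idempotent p" using that rank_one_projections_eq[OF assms(1)] by blast
    ultimately show ?thesis using \<alpha> socle_trace_minimal_idempotent[OF assms(1)] by simp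
  qed
  then show "f constant_on rank_one_projections" unfolding constant_on_def by blast
next
  assume "f constant_on rank_one_projections"
  then obtain \<alpha> where \<alpha>: "\<And>p. minimal_idempotent p \<Longrightarrow> f p = \<alpha>"
    unfolding constant_on_def rank_one_projections_eq[OF assms(1)] by blast
  have f_add: "f (x + y) = f x + f y" if "x \<in> socle" "y \<in> socle" for x y
    using assms(3) that by (simp add: linear_functional_on_def)
  have f_scaleC: "f (c *\<^sub>C x) = c * f x" if "x \<in> socle" for c x
    using assms(3) that by (simp add: linear_functional_on_def)
  show "\<exists>\<alpha>. \<forall>a\<in>socle. f a = \<alpha> * socle_trace a"
  proof (intro exI[of _ \<alpha>] ballI)
    fix a :: 'a assume a: "a \<in> socle"
    \<comment> \<open>Left multiples of a stay in the socle, which turns linearity on the socle into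
      linearity on A a.\<close>
    interpret constant_on_minimal a f \<alpha>
      by unfold_locales (auto simp: assms(1) a socle_mult f_add f_scaleC \<alpha>)
    show "f a = \<alpha> * socle_trace a"
    proof (cases "\<alpha> = 0")
      case True
      then show ?thesis using T_eq_zero by simp
    next
      case False
      interpret normalized: normalized_functional a "\<lambda>x. f x / \<alpha>"
        by unfold_locales
          (auto simp: assms(1) a T_add T_scaleC T_minimal add_divide_distrib False)
      show ?thesis using normalized.socle_trace_eq False by simp
    qed
  qed
qed

end
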